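(* Let $q$ be a prime power with $q\equiv1\pmod 4$ and let $d$ be an odd positive integer with $q\equiv-1\pmod d$. Let $s=\nu_2(q-1)$ (so $s\ge2$). Fix a primitive $2^s$-th root of unity $\alpha_{2^s}\in\mathbb{F}_q^*$ and put $\alpha_{2^k}=\alpha_{2^s}^{2^{s-k}}$ for $1\le k\le s$ (so $\alpha_2=-1$ and $\alpha_{2^{k-1}}=\alpha_{2^k}^2$); fix $\beta_{2^{s+1}}\in\mathbb{F}_{q^2}$ with $\beta_{2^{s+1}}^2=\alpha_{2^s}$ (a primitive $2^{s+1}$-th root of unity). Let $\gamma$ be a primitive $d$-th root of unity in $\mathbb{F}_{q^2}$ and set $\delta_j=\gamma^j+\gamma^{qj}$, $\theta_j=\gamma^j-\gamma^{qj}$. Then: (i) For $2\le k\le s$, $\Phi_{2^k}(x^d)$ factors into $2^{k-2}(d+1)$ monic irreducible factors over $\mathbb{F}_q$ as $$\Phi_{2^k}(x^d)=\prod_{i=1}^{2^{k-2}}\left[\left(x\pm\alpha_{2^k}^{2i-1}\right)\prod_{j=1}^{(d-1)/2}\left(x^2\pm\alpha_{2^k}^{2i-1}\delta_jx+\alpha_{2^{k-1}}^{2i-1}\right)\right].$$ (ii) For every integer $r\ge1$, $\Phi_{2^{s+r}}(x^d)$ factors into $2^{s-1}d$ monic irreducible factors over $\mathbb{F}_q$ as $$\Phi_{2^{s+r}}(x^d)=\prod_{i=1}^{2^{s-2}}\left[\left(x^{2^r}\pm\alpha_{2^s}^{2i-1}\right)\prod_{j=1}^{(d-1)/2}\prod_{l=0}^{1}\left(x^{2^r}\pm\alpha_4^{l}\beta_{2^{s+1}}^{2i-1}\theta_jx^{2^{r-1}}-\alpha_2^{l}\alpha_{2^s}^{2i-1}\right)\right].$$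 In particular all coefficients appearing above lie in $\mathbb{F}_q$.
   Context: $\nu_2(l)$ is the exponent of the largest power of $2$ dividing $l$; $\Phi_N$ is the $N$-th cyclotomic polynomial. Notation: for expressions $A,B$, the factor $(A\pm B)$ means the product $(A+B)(A-B)$; similarly $(x^2\pm ux+v)$ means $(x^2+ux+v)(x^2-ux+v)$ and $(x^{2^r}\pm ux^{2^{r-1}}+v)$ means $(x^{2^r}+ux^{2^{r-1}}+v)(x^{2^r}-ux^{2^{r-1}}+v)$. *)

theory Defs
  imports
    "HOL-Library.Cardinality"
    "HOL-Computational_Algebra.Computational_Algebra"
    "HOL-Number_Theory.Cong"
    "Subresultants.More_Homomorphisms"
begin

definition primitive_root_of_unity :: "nat \<Rightarrow> 'a::field \<Rightarrow> bool" where
  "primitive_root_of_unity n z \<longleftrightarrow> n > 0 \<and> z ^ n = 1 \<and> (\<forall>m. 0 < m \<and> m < n \<longrightarrow> z ^ m \<noteq> 1)"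

text \<open>
  The \<open>n\<close>-th cyclotomic polynomial as an integer polynomial; over another commutative ring it
  is read as its image \<open>of_int_poly (cyclotomic n)\<close>. The description is well defined, see
  \<open>of_int_poly_cyclotomic\<close> below.
\<close>

definition cyclotomic :: "nat \<Rightarrow> int poly" where
  "cyclotomic n = (THE p. of_int_poly p =
     (\<Prod>z | primitive_root_of_unity n (z::complex). [:- z, 1:]))"

lemma primitive_root_of_unity_dvd:
  fixes z :: "'a::field"
  assumes z: "primitive_root_of_unity d z" and n: "z ^ n = 1"
  shows "d dvd n"
proof -
  have "z ^ n = (z ^ d) ^ (n div d) * z ^ (n mod d)"
    by (simp flip: power_mult power_add)
  hence "z ^ (n mod d) = 1"
    using z n by (simp add: primitive_root_of_unity_def)
  moreover have "n mod d < d"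
    using z by (simp add: primitive_root_of_unity_def)
  ultimately have "n mod d = 0"
    using z by (auto simp: primitive_root_of_unity_def)
  thus ?thesis by auto
qed

lemma primitive_root_of_unity_exists_order:
  fixes z :: "'a::field"
  assumes "n > 0" "z ^ n = 1"
  shows "\<exists>d. d dvd n \<and> primitive_root_of_unity d z"
proof -
  define d where "d = (LEAST d. d > 0 \<and> z ^ d = 1)"
  have "d > 0 \<and> z ^ d = 1"
    unfolding d_def by (rule LeastI[of _ n]) (use assms in auto)
  moreover have "z ^ m \<noteq> 1" if "0 < m" "m < d" for m
    using not_less_Least[of m "\<lambda>d. d > 0 \<and> z ^ d = 1"] that by (auto simp: d_def)
  ultimately have "primitive_root_of_unity d z"
    by (auto simp: primitive_root_of_unity_def)
  thus ?thesis
    using primitive_root_of_unity_dvd assms(2) by blast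
qed

lemma finite_primitive_roots_of_unity: "finite {z::complex. primitive_root_of_unity n z}"
proof (cases "n = 0")
  case False
  hence "finite {z::complex. z ^ n = 1}"
    by (intro finite_roots_unity) auto
  thus ?thesis
    by (rule finite_subset[rotated]) (auto simp: primitive_root_of_unity_def)
qed (simp add: primitive_root_of_unity_def)

lemma prod_cyclotomic_complex:
  assumes n: "n > 0"
  shows "(\<Prod>d | d dvd n. \<Prod>z | primitive_root_of_unity d (z::complex). [:- z, 1:]) = monom 1 n - 1"
proof -
  define p :: "complex poly" where "p = monom 1 n - 1"
  have root: "poly p z = 0 \<longleftrightarrow> z ^ n = 1" for z
    by (simp add: p_def poly_monom)
  have "rsquarefree p"
    unfolding rsquarefree_roots
  proof safe
    fix z assume "poly p z = 0" "poly (pderiv p) z = 0"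
    moreover have "poly (pderiv p) z = of_nat n * z ^ (n - 1)"
      by (simp add: p_def pderiv_diff pderiv_monom poly_monom)
    ultimately have "z ^ n = 1" "z ^ (n - 1) = 0"
      using n root by auto
    thus False
      using n by (auto simp: power_0_left split: if_splits)
  qed
  hence "Polynomial.smult (lead_coeff p) (\<Prod>z | poly p z = 0. [:- z, 1:]) = p"
    by (rule complex_poly_decompose_rsquarefree)
  moreover have "lead_coeff p = 1"
  proof -
    have "degree p = n"
      unfolding p_def using n
      by (subst diff_conv_add_uminus, subst degree_add_eq_left) (auto simp: degree_monom_eq)
    thus ?thesis using n by (simp add: p_def)
  qed
  ultimately have "p = (\<Prod>z | z ^ n = 1. [:- z, 1:])"
    by (simp add: root)
  also have "{z::complex. z ^ n = 1} = (\<Union>d\<in>{d. d dvd n}. {z. primitive_root_of_unity d z})"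
    using primitive_root_of_unity_exists_order[OF n]
    by (auto simp: primitive_root_of_unity_def elim!: dvdE simp: power_mult)
  also have "(\<Prod>z\<in>\<dots>. [:- z, 1:]) =
      (\<Prod>d | d dvd n. \<Prod>z | primitive_root_of_unity d (z::complex). [:- z, 1:])"
  proof (rule prod.UNION_disjoint)
    show "finite {d. d dvd n}" using n by simp
    show "\<forall>d\<in>{d. d dvd n}. finite {z::complex. primitive_root_of_unity d z}"
      by (simp add: finite_primitive_roots_of_unity)
    show "\<forall>d\<in>{d. d dvd n}. \<forall>e\<in>{d. d dvd n}. d \<noteq> e \<longrightarrow>
        {z::complex. primitive_root_of_unity d z} \<inter> {z. primitive_root_of_unity e z} = {}"
    proof safe
      fix d e :: nat and z :: complex
      assume "d \<noteq> e" and d: "primitive_root_of_unity d z" and e: "primitive_root_of_unity e z"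
      have "d dvd e" "e dvd d"
        using primitive_root_of_unity_dvd[OF d] primitive_root_of_unity_dvd[OF e] d e
        by (auto simp: primitive_root_of_unity_def)
      with \<open>d \<noteq> e\<close> show "z \<in> {}" by (auto dest: dvd_antisym)
    qed
  qed
  finally show ?thesis by (simp add: p_def)
qed

lemma monic_int_poly_dvdD:
  fixes a f :: "int poly" and c :: "complex poly"
  assumes a: "lead_coeff a = 1" and eq: "of_int_poly f = of_int_poly a * c"
  shows "\<exists>b. c = of_int_poly b"
proof -
  obtain b r where br: "pseudo_divmod f a = (b, r)" by force
  have a0: "a \<noteq> 0" using a by auto
  have f: "f = a * b + r" and r: "r = 0 \<or> degree r < degree a"
    using pseudo_divmod[OF a0 br] a by auto
  have "of_int_poly a * c = of_int_poly a * of_int_poly b + (of_int_poly r :: complex poly)"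
    using eq unfolding f by (simp add: hom_distribs)
  hence r': "of_int_poly r = of_int_poly a * (c - of_int_poly b)"
    by (simp add: algebra_simps)
  have "c - of_int_poly b = 0"
  proof (rule ccontr)
    assume nz: "c - of_int_poly b \<noteq> 0"
    have "degree (of_int_poly r :: complex poly) = degree a + degree (c - of_int_poly b)"
      unfolding r' using a0 nz by (subst degree_mult_eq) auto
    moreover have "r \<noteq> 0" using r' nz a0 by auto
    ultimately show False using r by simp
  qed
  thus ?thesis by auto
qed

lemma cyclotomic_exists:
  "\<exists>p. of_int_poly p = (\<Prod>z | primitive_root_of_unity n (z::complex). [:- z, 1:])"
proof (induction n rule: less_induct)
  case (less n)
  define C where "C = (\<lambda>n. \<Prod>z | primitive_root_of_unity n (z::complex). [:- z, 1:])"
  show ?case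
  proof (cases "n = 0")
    case True
    thus ?thesis by (intro exI[of _ 1]) (simp add: primitive_root_of_unity_def)
  next
    case False
    from less have "\<forall>d\<in>{..<n}. \<exists>p. of_int_poly p = C d" by (auto simp: C_def)
    then obtain P where P: "of_int_poly (P d) = C d" if "d < n" for d
      by (auto simp: bchoice_iff)
    define D where "D = {d. d dvd n} - {n}"
    have D: "finite D" "d < n" if "d \<in> D" for d
      using False that by (auto simp: D_def dest: dvd_imp_le le_neq_implies_less)
    define a where "a = (\<Prod>d\<in>D. P d)"
    have a: "of_int_poly a = (\<Prod>d\<in>D. C d)"
      unfolding a_def by (simp add: hom_distribs P D)
    have "lead_coeff (of_int_poly a :: complex poly) = 1"
      unfolding a C_def by (simp add: lead_coeff_prod)
    hence la: "lead_coeff a = 1" by simp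
    have "of_int_poly (monom 1 n - 1) = (monom 1 n - 1 :: complex poly)"
      by (simp add: hom_distribs)
    also have "\<dots> = (\<Prod>d | d dvd n. C d)"
      unfolding C_def using False by (intro prod_cyclotomic_complex[symmetric]) simp
    also have "\<dots> = C n * (\<Prod>d\<in>D. C d)"
      unfolding D_def using False by (subst prod.remove[of _ n]) auto
    finally have "of_int_poly (monom 1 n - 1) = of_int_poly a * C n"
      by (simp add: a)
    from monic_int_poly_dvdD[OF la this] show ?thesis by (auto simp: C_def)
  qed
qed

lemma of_int_poly_cyclotomic:
  "of_int_poly (cyclotomic n) = (\<Prod>z | primitive_root_of_unity n (z::complex). [:- z, 1:])"
proof -
  obtain p where p: "of_int_poly p = (\<Prod>z | primitive_root_of_unity n (z::complex). [:- z, 1:])"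
    using cyclotomic_exists by blast
  show ?thesis
    unfolding cyclotomic_def unfolding p[symmetric] by (rule theI[of _ p]) auto
qed

text \<open>
  For a field embedding \<open>h\<close> of \<open>K\<close> into \<open>L\<close>: the polynomial \<open>f\<close> over \<open>K\<close> is the product of
  \<open>n\<close> monic irreducible polynomials over \<open>K\<close> (counted with multiplicity), and these are,
  viewed over \<open>L\<close>, the members of \<open>M\<close>. In particular, all coefficients of members of \<open>M\<close> lie
  in the image of \<open>K\<close>.
\<close>

definition factors_into_monic_irreducibles ::
    "('a::field \<Rightarrow> 'b::field) \<Rightarrow> 'a poly \<Rightarrow> nat \<Rightarrow> 'b poly multiset \<Rightarrow> bool" where
  "factors_into_monic_irreducibles h f n M \<longleftrightarrow>
     (\<exists>G. f = prod_mset G \<and> size G = n \<and> (\<forall>g\<in>#G. lead_coeff g = 1 \<and> irreducible g) \<and>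
          M = image_mset (map_poly h) G)"

end

theory Submission
  imports Defs
begin

text \<open>
  Since \<open>d\<close> divides \<open>q + 1\<close>, \<open>\<gamma>\<^sup>q\<close> is the inverse of \<open>\<gamma>\<close>, so the quadratics
  split over the quadratic extension into linear factors that regroup to \<open>Y\<^sup>d - c\<^sup>d = \<Prod>(Y - c \<gamma>\<^sup>j)\<close>; the
  factorisations then follow from \<open>\<Prod>(y - w ^ (2 i - 1)) = y ^ (2 ^ m) + 1\<close> for \<open>w ^ (2 ^ m) = - 1\<close>.
  In (i) the roots \<open>c \<gamma>\<^sup>j\<close> are not fixed by the Frobenius map. In (ii) an irreducible factor of degree
  \<open>m\<close> divides \<open>x ^ (q ^ m - 1) - 1\<close>, while its roots have order divisible by \<open>2 ^ (s + r)\<close>; hence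
  \<open>2 ^ (s + r)\<close> divides \<open>q ^ m - 1\<close>, which forces \<open>2 ^ r\<close> to divide \<open>m\<close>.
\<close>

section \<open>Irreducibility from the degrees of monic factors\<close>

text \<open>If some monic irreducible factor has full degree, its cofactor is a unit. Irreducibility
  thus becomes a lower bound on the degrees of irreducible factors: in (i) no factor is linear, in
  (ii) all these degrees are multiples of \<open>2 ^ r\<close>.\<close>

lemma irreducible_monic_factorI:
  fixes g :: "'a::field poly"
  assumes deg: "degree g > 0"
    and factor: "\<And>f. irreducible f \<Longrightarrow> lead_coeff f = 1 \<Longrightarrow> f dvd g \<Longrightarrow> degree g \<le> degree f"
  shows "irreducible g"
proof -
  obtain f c where f: "irreducible f" "lead_coeff f = 1" and c: "g = f * c"
    using irreducible_monic_factor[OF deg] by blast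
  have "g \<noteq> 0" using deg by auto
  hence [simp]: "f \<noteq> 0" "c \<noteq> 0" using c by auto
  have "degree f + degree c \<le> degree f"
    using factor[OF f] by (simp add: c degree_mult_eq)
  hence "is_unit c" by (simp add: is_unit_iff_degree)
  thus ?thesis using f(1) by (simp add: c irreducible_mult_unit_right)
qed

lemma degree_1_monic_factor_root:
  fixes f g :: "'a::field poly"
  assumes "degree f = 1" "lead_coeff f = 1" "f dvd g"
  obtains a where "poly g a = 0"
proof -
  obtain u v where "f = [:u, v:]" using degree1_coeffs[OF assms(1)] by blast
  hence "poly f (- u) = 0" using assms by auto
  thus thesis using that[of "- u"] assms(3) by auto
qed

section \<open>Finite fields and their Frobenius map\<close>

text \<open>Splitting off the constant coefficient with \<open>pCons\<close> gives the induction.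
  The condition on coefficients, unlike a strict degree bound, still admits the zero polynomial when
  \<open>n = 0\<close>.\<close>

lemma card_polys_bounded_degree:
  "finite {p :: 'a::{field,finite} poly. \<forall>i\<ge>n. coeff p i = 0} \<and>
   card {p :: 'a poly. \<forall>i\<ge>n. coeff p i = 0} = CARD('a) ^ n"
proof (induction n)
  case 0
  have "{p :: 'a poly. \<forall>i\<ge>0. coeff p i = 0} = {0}" by (auto intro: poly_eqI)
  thus ?case by simp
next
  case (Suc n)
  let ?S = "\<lambda>n. {p :: 'a poly. \<forall>i\<ge>n. coeff p i = 0}"
  have "?S (Suc n) = (\<lambda>(a, p). pCons a p) ` (UNIV \<times> ?S n)"
  proof (intro equalityI subsetI)
    fix p assume "p \<in> ?S (Suc n)"
    moreover obtain a p' where "p = pCons a p'" by (cases p) auto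
    ultimately have "(a, p') \<in> UNIV \<times> ?S n" by (auto simp: coeff_pCons split: nat.splits)
    thus "p \<in> (\<lambda>(a, p). pCons a p) ` (UNIV \<times> ?S n)" using \<open>p = _\<close> by force
  qed (auto simp: coeff_pCons split: nat.splits)
  moreover have "inj_on (\<lambda>(a, p). pCons a p) (UNIV \<times> ?S n)" by (auto simp: inj_on_def)
  ultimately show ?case using Suc by (simp add: card_image card_cartesian_product)
qed

text \<open>Multiplication by \<open>x\<close> permutes the nonzero residues modulo \<open>f\<close>; compare their products.\<close>

lemma irreducible_dvd_monom_minus_1:
  fixes f :: "'a::{field,finite} poly"
  assumes f: "irreducible f" and x: "\<not> f dvd [:0, 1:]"
  shows "f dvd monom 1 (CARD('a) ^ degree f - 1) - 1"
proof -
  define x :: "'a poly" where "x = [:0, 1:]"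
  define S where "S = {p :: 'a poly. \<forall>i\<ge>degree f. coeff p i = 0} - {0}"
  have prime: "prime_elem f" using f by (rule field_poly_irreducible_imp_prime)
  hence f0: "f \<noteq> 0" and nunit: "\<not> is_unit f" by (auto simp: prime_elem_def)
  hence deg: "degree f > 0" by (simp add: is_unit_iff_degree)
  have S_iff: "p \<in> S \<longleftrightarrow> p \<noteq> 0 \<and> degree p < degree f" for p
  proof -
    have "p \<noteq> 0 \<Longrightarrow> degree p < degree f" if "\<forall>i\<ge>degree f. coeff p i = 0"
      using that leading_coeff_0_iff not_le by blast
    thus ?thesis by (auto simp: S_def coeff_eq_0)
  qed
  have finS: "finite S" and cardS: "card S = CARD('a) ^ degree f - 1"
    using card_polys_bounded_degree[where 'a = 'a, of "degree f"] by (auto simp: S_def)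
  have ndvd: "\<not> f dvd p" if "p \<in> S" for p
    using that dvd_imp_degree_le[of f p] by (auto simp: S_iff)
  have ndvd_x: "\<not> f dvd x * p" if "p \<in> S" for p
    using ndvd[OF that] x prime by (auto simp: x_def prime_elem_dvd_mult_iff simp del: mult_pCons_left)
  have maps: "(\<lambda>p. (x * p) mod f) ` S \<subseteq> S"
  proof safe
    fix p assume "p \<in> S"
    hence "(x * p) mod f \<noteq> 0" using ndvd_x by (simp add: dvd_eq_mod_eq_0)
    thus "(x * p) mod f \<in> S" using degree_mod_less[OF f0, of "x * p"] by (auto simp: S_iff)
  qed
  have inj: "inj_on (\<lambda>p. (x * p) mod f) S"
  proof (rule inj_onI)
    fix p r assume pr: "p \<in> S" "r \<in> S" "(x * p) mod f = (x * r) mod f"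
    hence "f dvd x * (p - r)" by (simp add: mod_eq_dvd_iff right_diff_distrib del: mult_pCons_left)
    hence dvd: "f dvd p - r" using x prime by (auto simp: x_def prime_elem_dvd_mult_iff simp del: mult_pCons_left)
    have "degree (p - r) < degree f" using pr deg by (intro degree_diff_less) (auto simp: S_iff)
    thus "p = r" using dvd_imp_degree_le[OF dvd] by force
  qed
  have img: "(\<lambda>p. (x * p) mod f) ` S = S" by (rule endo_inj_surj[OF finS maps inj])
  have "[(\<Prod>p\<in>S. x * p) = (\<Prod>p\<in>S. (x * p) mod f)] (mod f)"
    by (rule cong_prod) (simp add: cong_def)
  also have "(\<Prod>p\<in>S. (x * p) mod f) = (\<Prod>p\<in>(\<lambda>p. (x * p) mod f) ` S. p)"
    using inj by (simp add: prod.reindex)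
  finally have "[x ^ card S * \<Prod>S = \<Prod>S] (mod f)"
    unfolding img by (simp add: prod.distrib)
  hence "f dvd (x ^ card S - 1) * \<Prod>S" by (simp add: cong_iff_dvd_diff left_diff_distrib)
  \<comment> \<open>Since \<open>f\<close> is prime and divides no member of \<open>S\<close>, the
    product over \<open>S\<close> can be cancelled; the claim ranges over subsets to allow induction
    on a finite set.\<close>
  moreover have "\<not> f dvd \<Prod>T" if "T \<subseteq> S" for T
    using finite_subset[OF that finS] that
    by (induction T) (use nunit ndvd in \<open>auto simp: prime_elem_dvd_mult_iff[OF prime]\<close>)
  ultimately have "f dvd x ^ card S - 1" using prime by (auto simp: prime_elem_dvd_mult_iff)
  moreover have "x ^ n = monom 1 n" for n by (simp add: x_def monom_altdef)
  ultimately show ?thesis by (simp add: cardS)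
qed

text \<open>This is the case of the linear polynomial with root \<open>a\<close>: it divides
  \<open>x ^ (CARD('a) - 1) - 1\<close>, which therefore vanishes at \<open>a\<close>.\<close>

lemma power_card_minus_1_eq_1:
  fixes a :: "'a::{field,finite}"
  assumes "a \<noteq> 0"
  shows "a ^ (CARD('a) - 1) = 1"
proof -
  have "irreducible [:- a, 1:]" by (rule irreducible_linear_field_poly) simp
  moreover have "\<not> [:- a, 1:] dvd [:0, 1:]" using assms poly_eq_0_iff_dvd[of "[:0, 1:]" a] by auto
  ultimately have "[:- a, 1:] dvd monom 1 (CARD('a) - 1) - 1"
    using irreducible_dvd_monom_minus_1[of "[:- a, 1:]"] by simp
  thus ?thesis unfolding poly_eq_0_iff_dvd[symmetric] by (simp add: poly_monom)
qed

lemma power_card_eq: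
  fixes a :: "'a::{field,finite}"
  shows "a ^ CARD('a) = a"
proof (cases "a = 0")
  case False
  have "a ^ CARD('a) = a * a ^ (CARD('a) - 1)"
    by (simp add: power_eq_if)
  thus ?thesis using power_card_minus_1_eq_1[OF False] by simp
qed simp

lemma card_field_gt_1: "CARD('a::{field,finite}) > 1"
  using card_mono[of UNIV "{0 :: 'a, 1}"] by simp

text \<open>With \<open>q = CARD('a)\<close>, the polynomial \<open>x ^ q - x\<close> has at most
  \<open>q\<close> roots, and the \<open>q\<close> elements of the image of \<open>h\<close> are
  already roots. This makes the Frobenius map the test for membership in the subfield.\<close>

lemma power_card_eq_iff_in_range:
  fixes h :: "'a::{field,finite} \<Rightarrow> 'b::field"
  assumes "field_hom h"
  shows "z ^ CARD('a) = z \<longleftrightarrow> z \<in> range h"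
proof -
  interpret field_hom h by fact
  define p :: "'b poly" where "p = monom 1 CARD('a) - monom 1 1"
  have card: "CARD('a) > 1" by (rule card_field_gt_1)
  have root: "poly p y = 0 \<longleftrightarrow> y ^ CARD('a) = y" for y by (simp add: p_def poly_monom)
  have "coeff p CARD('a) = 1" using card by (simp add: p_def)
  hence p0: "p \<noteq> 0" by auto
  have "degree p \<le> CARD('a)"
    unfolding p_def using card by (intro degree_diff_le) (auto simp: degree_monom_eq)
  hence "card {y. poly p y = 0} \<le> card (range h)"
    using card_poly_roots_bound[OF p0] by (simp add: card_image inj_f)
  moreover have "range h \<subseteq> {y. poly p y = 0}"
    by (auto simp: root power_card_eq simp flip: hom_power)
  ultimately have "range h = {y. poly p y = 0}"
    using poly_roots_finite[OF p0] by (intro card_seteq) auto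
  thus ?thesis using root by auto
qed

text \<open>
  Both sides are monic of degree \<open>q\<close> in \<open>y\<close>, so it suffices to compare them at the \<open>q\<close> elements of
  the subfield. For \<open>x\<close> in the subfield this is clear; then exchange the roles of \<open>x\<close> and \<open>y\<close>.
\<close>

lemma add_power_card_subfield:
  fixes h :: "'a::{field,finite} \<Rightarrow> 'b::field" and x y :: 'b
  assumes "field_hom h"
  shows "(x + y) ^ CARD('a) = x ^ CARD('a) + y ^ CARD('a)"
proof -
  interpret field_hom h by fact
  let ?q = "CARD('a)"
  have q0: "?q > 0" by (simp add: finite_UNIV_card_ge_0)
  have extend: "(x + y) ^ ?q = x ^ ?q + y ^ ?q"
    if "\<And>z. z \<in> range h \<Longrightarrow> (x + z) ^ ?q = x ^ ?q + z ^ ?q" for x y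
  proof -
    have "[:x, 1:] ^ ?q = [:x ^ ?q:] + monom 1 ?q"
    proof (rule poly_eqI_degree_lead_coeff[where n = ?q and A = "range h"])
      show "coeff ([:x, 1:] ^ ?q) ?q = coeff ([:x ^ ?q:] + monom 1 ?q) ?q"
        using q0 lead_coeff_power[of "[:x, 1:]" ?q]
        by (simp add: degree_linear_power coeff_pCons split: nat.splits del: pCons_one)
      show "?q \<le> card (range h)" by (simp add: card_image inj_f)
      show "degree ([:x, 1:] ^ ?q) \<le> ?q" by (simp add: degree_linear_power del: pCons_one)
      show "degree ([:x ^ ?q:] + monom 1 ?q) \<le> ?q"
        by (intro degree_add_le) (auto simp: degree_monom_eq)
    qed (auto simp: poly_monom that)
    from arg_cong[OF this, of "\<lambda>p. poly p y"] show ?thesis by (simp add: poly_monom add_ac)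
  qed
  have sub: "(u + v) ^ ?q = u ^ ?q + v ^ ?q" if "u \<in> range h" "v \<in> range h" for u v
  proof -
    have "u + v \<in> range h" using that by (auto simp flip: hom_add)
    thus ?thesis using that by (simp flip: power_card_eq_iff_in_range[OF assms])
  qed
  show ?thesis
  proof (rule extend)
    fix z assume "z \<in> range h"
    hence "(z + x) ^ ?q = z ^ ?q + x ^ ?q" by (intro extend[of z x] sub)
    thus "(x + z) ^ ?q = x ^ ?q + z ^ ?q" by (simp add: add_ac)
  qed
qed

section \<open>Powers of two and the degrees of irreducible factors\<close>

text \<open>For odd \<open>m\<close> the quotient of \<open>q ^ m - 1\<close> by
  \<open>q - 1\<close> is odd, so \<open>m\<close> must be even once \<open>r > 0\<close>. Replacing
  \<open>q\<close> by its square then halves \<open>m\<close> and raises \<open>s\<close> by exactly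
  one; here \<open>s \<ge> 2\<close> keeps the new cofactor odd. Hence the induction lets
  \<open>q\<close>, \<open>s\<close>, \<open>t\<close> and \<open>m\<close> vary.\<close>

lemma two_power_dvd_power_minus_1_imp_dvd:
  fixes q :: int
  assumes "q = 1 + 2 ^ s * t" "odd t" "s \<ge> 2" "2 ^ (s + r) dvd q ^ m - 1"
  shows "2 ^ r dvd m"
  using assms
proof (induction r arbitrary: q s t m)
  case (Suc r)
  have "even m"
  proof (rule ccontr)
    assume "odd m"
    have "even q \<longleftrightarrow> False" using Suc.prems by simp
    \<comment> \<open>Each of the \<open>n\<close> summands is congruent to one modulo two, because
      \<open>q\<close> is odd.\<close>
    hence "even ((\<Sum>i<n. q ^ i) - int n)" for n by (induction n) auto
    from this[of m] have "odd (\<Sum>i<m. q ^ i)" using \<open>odd m\<close> by simp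
    moreover have "q ^ m - 1 = 2 ^ s * (t * (\<Sum>i<m. q ^ i))"
      by (subst power_diff_1_eq) (simp add: Suc.prems(1))
    moreover have "(2::int) ^ s * 2 dvd 2 ^ (s + Suc r)" by (simp add: power_add)
    ultimately have "(2::int) ^ s * 2 dvd 2 ^ s * (t * (\<Sum>i<m. q ^ i))"
      using Suc.prems(4) dvd_trans by metis
    hence "even (t * (\<Sum>i<m. q ^ i))" by simp
    thus False using \<open>odd t\<close> \<open>odd (\<Sum>i<m. q ^ i)\<close> by simp
  qed
  then obtain k where k: "m = 2 * k" by blast
  obtain v where v: "s = Suc (Suc v)" using Suc.prems(3) by (metis add_2_eq_Suc le_Suc_ex)
  have "2 ^ r dvd k"
  proof (rule Suc.IH)
    show "q\<^sup>2 = 1 + 2 ^ Suc s * (t + 2 ^ (s - 1) * t\<^sup>2)"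
      unfolding Suc.prems(1) v by (simp add: power2_eq_square algebra_simps)
    show "odd (t + 2 ^ (s - 1) * t\<^sup>2)" using Suc.prems v by simp
    show "2 ^ (Suc s + r) dvd (q\<^sup>2) ^ k - 1" using Suc.prems(4) by (simp add: k power_mult)
  qed (use Suc.prems in simp)
  thus ?case by (simp add: k)
qed simp

text \<open>Modulo \<open>f\<close> the class of \<open>x\<close> satisfies
  \<open>x ^ (N * 2 ^ (s + r - 1)) = - 1\<close> with \<open>N\<close> odd, so the 2-part of its
  order is \<open>2 ^ (s + r)\<close>. That order divides \<open>CARD('a) ^ degree f - 1\<close>,
  and the preceding lemma passes the divisibility on to the degree.\<close>

lemma two_power_dvd_degree_irreducible_factor:
  fixes f :: "'a::{field,finite} poly"
  assumes f: "irreducible f" and dvd: "f dvd monom 1 (N * 2 ^ (s + r - 1)) + 1"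
    and N: "odd N" and two: "(2::'a) \<noteq> 0"
    and q: "int CARD('a) = 1 + 2 ^ s * t" "odd t" "s \<ge> 2"
  shows "2 ^ r dvd degree f"
proof -
  define M where "M = CARD('a) ^ degree f - 1"
  let ?e = "N * 2 ^ (s + r - 1)"
  have nunit: "\<not> is_unit f" using f unfolding irreducible_def by blast
  moreover have "f \<noteq> 0" using f unfolding irreducible_def by blast
  ultimately have deg: "degree f > 0" by (simp add: is_unit_iff_degree)
  have nx: "\<not> f dvd [:0, 1:]"
  proof
    assume "f dvd [:0, 1:]"
    moreover have "[:0, 1:] dvd (monom 1 ?e :: 'a poly)"
      using odd_pos[OF N] by (simp add: monom_altdef dvd_power)
    ultimately have "f dvd monom 1 ?e" by (rule dvd_trans)
    thus False using dvd nunit by (simp add: dvd_add_right_iff)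
  qed
  have M0: "M > 0" using one_less_power[OF card_field_gt_1[where 'a = 'a] deg] by (simp add: M_def)
  have int_M: "int M = int CARD('a) ^ degree f - 1"
    using M0 by (simp add: M_def of_nat_diff)
  have M1: "[monom 1 M = 1] (mod f)"
    using irreducible_dvd_monom_minus_1[OF f nx] by (simp add: M_def cong_iff_dvd_diff)
  have E1: "[monom 1 ?e = - 1] (mod f)" using dvd by (simp add: cong_iff_dvd_diff)
  obtain u where u: "M = 2 ^ multiplicity 2 M * u" "odd u"
    using multiplicity_decompose'[of M 2] M0 by auto
  have pw: "monom 1 a ^ b = (monom 1 (a * b) :: 'a poly)" for a b
    by (simp add: monom_power)
  have "2 ^ (s + r) dvd M"
  proof (rule ccontr)
    assume "\<not> ?thesis"
    hence "multiplicity 2 M < s + r" using M0 by (simp add: power_dvd_iff_le_multiplicity)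
    hence le: "multiplicity 2 M \<le> s + r - 1" by simp
    \<comment> \<open>As \<open>u\<close> is the odd part of \<open>M\<close>, the odd multiple
      \<open>?e * u\<close> of \<open>?e\<close> is also a multiple of \<open>M\<close>. The two
      congruences then give \<open>x ^ (?e * u)\<close> both values \<open>1\<close> and
      \<open>- 1\<close> modulo \<open>f\<close>.\<close>
    have "M dvd 2 ^ (s + r - 1) * u"
      by (subst u(1)) (intro mult_dvd_mono le_imp_power_dvd le dvd_refl)
    hence "M dvd ?e * u" by (simp add: mult.assoc)
    then obtain c where c: "?e * u = M * c" by (elim dvdE)
    have "[monom 1 M ^ c = 1] (mod f)" using cong_pow[OF M1, of c] by simp
    moreover have "[monom 1 ?e ^ u = - 1] (mod f)" using cong_pow[OF E1, of u] u(2) by simp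
    ultimately have "[1 = - 1] (mod f)" unfolding pw c by (metis cong_sym cong_trans)
    hence "f dvd 2" by (simp add: cong_iff_dvd_diff)
    moreover have "is_unit (2 :: 'a poly)" using two by (simp add: numeral_poly is_unit_const_poly_iff)
    ultimately show False using nunit dvd_trans by blast
  qed
  hence "2 ^ (s + r) dvd int CARD('a) ^ degree f - 1"
    unfolding int_M[symmetric] by (metis of_nat_dvd_iff of_nat_numeral of_nat_power)
  thus ?thesis by (rule two_power_dvd_power_minus_1_imp_dvd[OF q])
qed

section \<open>Product formulas for two-power cyclotomic polynomials and roots of unity\<close>

text \<open>The only divisor of \<open>2 ^ Suc n\<close> that does not divide \<open>2 ^ n\<close>
  is \<open>2 ^ Suc n\<close> itself, so the polynomial is the quotient of
  \<open>x ^ (2 ^ Suc n) - 1\<close> by \<open>x ^ (2 ^ n) - 1\<close>. The computation runs over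
  the complex numbers and descends by injectivity of \<open>of_int_poly\<close>.\<close>

lemma cyclotomic_two_power: "cyclotomic (2 ^ Suc n) = monom 1 (2 ^ n) + 1"
proof -
  define C where "C = (\<lambda>n. \<Prod>z | primitive_root_of_unity n (z::complex). [:- z, 1:])"
  have divisors: "{d. d dvd (2::nat) ^ Suc n} = insert (2 ^ Suc n) {d. d dvd 2 ^ n}"
    by (auto simp: divides_primepow_nat le_Suc_eq simp del: power_Suc)
  have "(monom 1 (2 ^ n) - 1) * (monom 1 (2 ^ n) + 1) = (monom 1 (2 ^ Suc n) - 1 :: complex poly)"
    by (simp add: algebra_simps mult_monom flip: mult_2)
  also have "\<dots> = (\<Prod>d | d dvd 2 ^ Suc n. C d)"
    unfolding C_def by (rule prod_cyclotomic_complex[symmetric]) simp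
  also have "\<dots> = C (2 ^ Suc n) * (\<Prod>d | d dvd 2 ^ n. C d)"
    unfolding divisors by (subst prod.insert) (auto dest: dvd_imp_le)
  also have "(\<Prod>d | d dvd 2 ^ n. C d) = monom 1 (2 ^ n) - 1"
    unfolding C_def by (rule prod_cyclotomic_complex) simp
  finally have "(monom 1 (2 ^ n) - 1) * (monom 1 (2 ^ n) + 1) = (monom 1 (2 ^ n) - 1) * C (2 ^ Suc n)"
    by (simp only: mult_ac)
  moreover have "coeff (monom 1 (2 ^ n) - 1 :: complex poly) (2 ^ n) = 1" by (simp add: coeff_1)
  hence "(monom 1 (2 ^ n) - 1 :: complex poly) \<noteq> 0" by (metis coeff_0 zero_neq_one)
  ultimately have "C (2 ^ Suc n) = monom 1 (2 ^ n) + 1" by (metis mult_left_cancel)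
  hence "of_int_poly (cyclotomic (2 ^ Suc n)) = (of_int_poly (monom 1 (2 ^ n) + 1) :: complex poly)"
    by (simp add: of_int_poly_cyclotomic C_def hom_distribs)
  thus ?thesis by (simp only: of_int_poly_hom.eq_iff)
qed

text \<open>Moving \<open>i\<close> by half of the index range negates
  \<open>w ^ (2 * i - 1)\<close>; pairing the two halves leaves the same product for the squares of
  \<open>y\<close> and \<open>w\<close>. The setting is a commutative ring because \<open>y\<close>
  and \<open>w\<close> will be polynomials, with \<open>w\<close> constant.\<close>

lemma prod_odd_powers:
  fixes w y :: "'a::comm_ring_1"
  assumes "w ^ 2 ^ m = - 1"
  shows "(\<Prod>i = 1..2 ^ m. y - w ^ (2 * i - 1)) = y ^ 2 ^ m + 1"
  using assms
proof (induction m arbitrary: w y)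
  case (Suc m)
  let ?n = "2 ^ m :: nat"
  have split: "{1..2 ^ Suc m} = {1..?n} \<union> {1 + ?n..?n + ?n}" by auto
  have "(\<Prod>i = 1..2 ^ Suc m. y - w ^ (2 * i - 1)) =
      (\<Prod>i = 1..?n. y - w ^ (2 * i - 1)) * (\<Prod>i = 1 + ?n..?n + ?n. y - w ^ (2 * i - 1))"
    unfolding split by (rule prod.union_disjoint) auto
  also have "(\<Prod>i = 1 + ?n..?n + ?n. y - w ^ (2 * i - 1)) = (\<Prod>i = 1..?n. y - w ^ (2 * (i + ?n) - 1))"
    by (rule prod.shift_bounds_cl_nat_ivl)
  also have "\<dots> = (\<Prod>i = 1..?n. y + w ^ (2 * i - 1))"
  proof (rule prod.cong[OF refl])
    fix i assume "i \<in> {1..?n}"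
    hence "2 * (i + ?n) - 1 = (2 * i - 1) + 2 ^ Suc m" by simp
    thus "y - w ^ (2 * (i + ?n) - 1) = y + w ^ (2 * i - 1)" by (simp only: power_add Suc.prems) simp
  qed
  also have "(\<Prod>i = 1..?n. y - w ^ (2 * i - 1)) * \<dots> = (\<Prod>i = 1..?n. y\<^sup>2 - (w\<^sup>2) ^ (2 * i - 1))"
    by (simp add: power2_eq_square algebra_simps power_mult_distrib flip: prod.distrib)
  also have "\<dots> = (y\<^sup>2) ^ ?n + 1" using Suc.prems by (intro Suc.IH) (simp add: power_mult)
  finally show ?case by (simp add: power_mult)
qed simp

text \<open>For \<open>Y = x\<close> both sides are monic of degree \<open>d\<close> and agree at
  the points \<open>c * \<gamma> ^ j\<close>, which are distinct since \<open>c \<noteq> 0\<close>;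
  composing with \<open>Y\<close> gives the general case. In (ii) \<open>Y\<close> is a power of
  \<open>x\<close>.\<close>

lemma prod_minus_primitive_root_powers:
  fixes c \<gamma> :: "'a::field" and Y :: "'a poly"
  assumes \<gamma>: "primitive_root_of_unity d \<gamma>" and c: "c \<noteq> 0"
  shows "(\<Prod>j<d. Y - [:c * \<gamma> ^ j:]) = Y ^ d - [:c ^ d:]"
proof -
  have d0: "d > 0" and \<gamma>d: "\<gamma> ^ d = 1" using \<gamma> by (auto simp: primitive_root_of_unity_def)
  hence \<gamma>0: "\<gamma> \<noteq> 0" by (auto simp: power_0_left)
  have neq: "\<gamma> ^ i \<noteq> \<gamma> ^ j" if "i < j" "j < d" for i j
  proof
    assume "\<gamma> ^ i = \<gamma> ^ j"
    also have "\<dots> = \<gamma> ^ i * \<gamma> ^ (j - i)" using that by (simp flip: power_add)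
    finally have "\<gamma> ^ (j - i) = 1" using \<gamma>0 by simp
    thus False using \<gamma> that by (auto simp: primitive_root_of_unity_def)
  qed
  have inj: "inj_on (\<lambda>j. c * \<gamma> ^ j) {..<d}"
    using c by (intro linorder_inj_onI) (auto dest: neq)
  have "(\<Prod>j<d. [:- (c * \<gamma> ^ j), 1:]) = monom 1 d - [:c ^ d:]" (is "?l = ?r")
  proof (rule poly_eqI_degree_lead_coeff[where n = d and A = "(\<lambda>j. c * \<gamma> ^ j) ` {..<d}"])
    have deg: "degree ?l = d" by (subst degree_prod_eq_sum_degree) auto
    show "degree ?l \<le> d" by (rule eq_imp_le[OF deg])
    have "lead_coeff ?l = 1" by (simp add: lead_coeff_prod)
    hence "coeff ?l d = 1" by (simp only: deg)
    moreover have "coeff ?r d = 1" using d0 by (simp add: coeff_pCons split: nat.splits)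
    ultimately show "coeff ?l d = coeff ?r d" by simp
    show "degree ?r \<le> d" by (intro degree_diff_le) (auto simp: degree_monom_eq)
    show "d \<le> card ((\<lambda>j. c * \<gamma> ^ j) ` {..<d})" using inj by (simp add: card_image)
    fix z assume "z \<in> (\<lambda>j. c * \<gamma> ^ j) ` {..<d}"
    then obtain j where j: "j < d" "z = c * \<gamma> ^ j" by auto
    have "z ^ d = c ^ d * (\<gamma> ^ d) ^ j" by (simp add: j power_mult_distrib mult.commute flip: power_mult)
    hence "poly ?r z = 0" by (simp add: poly_monom \<gamma>d)
    moreover have "poly ?l z = 0" using j by (auto simp: poly_prod)
    ultimately show "poly ?l z = poly ?r z" by simp
  qed
  moreover have "[:- a, 1:] \<circ>\<^sub>p Y = Y - [:a:]" for a
    by (subst diff_conv_add_uminus) (simp add: pcompose_pCons add.commute)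
  moreover have "monom 1 d \<circ>\<^sub>p Y = Y ^ d"
    by (simp add: monom_altdef pcompose_hom.hom_power pcompose_pCons)
  ultimately show ?thesis
    by (metis (no_types, lifting) pcompose_prod pcompose_diff pcompose_const prod.cong)
qed

section \<open>Descent of factorisations to the smaller field\<close>

text \<open>
  Irreducibility of \<open>g\<close> may be shown assuming \<open>g dvd f\<close>: this avoids descending divisibility from
  \<open>'b poly\<close> to \<open>'a poly\<close>.
\<close>

lemma factors_into_monic_irreduciblesI:
  fixes h :: "'a::field \<Rightarrow> 'b::field"
  assumes h: "field_hom h" and prod: "map_poly h f = prod_mset M" and size: "size M = n"
    and M: "\<And>p. p \<in># M \<Longrightarrow> \<exists>g. p = map_poly h g \<and> lead_coeff g = 1 \<and> (g dvd f \<longrightarrow> irreducible g)"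
  shows "factors_into_monic_irreducibles h f n M"
proof -
  interpret field_hom h by fact
  interpret map_poly_hom: map_poly_inj_idom_hom h ..
  from M obtain G where G: "map_poly h (G p) = p \<and> lead_coeff (G p) = 1 \<and> (G p dvd f \<longrightarrow> irreducible (G p))"
    if "p \<in># M" for p by metis
  have M_eq: "image_mset (map_poly h) (image_mset G M) = M"
    unfolding image_mset.compositionality comp_def using G by (intro multiset.map_ident_strong) auto
  \<comment> \<open>Injectivity of \<open>map_poly h\<close> turns the product over
    \<open>'b\<close> into one over \<open>'a\<close>; from it each \<open>G p\<close> is seen to
    divide \<open>f\<close>, which releases the conditional irreducibility.\<close>
  have "map_poly h (prod_mset (image_mset G M)) = prod_mset (image_mset (map_poly h) (image_mset G M))"
    by (simp only: map_poly_hom.hom_prod_mset)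
  hence f: "f = prod_mset (image_mset G M)" unfolding M_eq prod[symmetric] by simp
  have "G p dvd f" if "p \<in># M" for p unfolding f using that by (intro dvd_prod_mset) auto
  thus ?thesis
    unfolding factors_into_monic_irreducibles_def using G size M_eq f
    by (intro exI[of _ "image_mset G M"]) auto
qed

lemma prod_mset_sum: "prod_mset (\<Sum>i\<in>A. f i) = (\<Prod>i\<in>A. prod_mset (f i))"
  by (induction A rule: infinite_finite_induct) auto

section \<open>Conjugate powers of a root of unity and the quadratics they give\<close>

locale odd_order_root_of_unity = field_hom h
  for h :: "'a::{field,finite} \<Rightarrow> 'b::field" +
  fixes q d :: nat and \<gamma> :: 'b
  assumes card_eq: "CARD('a) = q" and odd_d: "odd d" and d_dvd: "d dvd q + 1" and \<gamma>: "primitive_root_of_unity d \<gamma>"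
begin

lemmas frobenius_add = add_power_card_subfield[OF field_hom_axioms, unfolded card_eq]
lemmas power_q_eq_iff = power_card_eq_iff_in_range[OF field_hom_axioms, unfolded card_eq]

lemma \<gamma>_nz: "\<gamma> \<noteq> 0"
  using \<gamma> by (auto simp: primitive_root_of_unity_def power_0_left split: if_splits)

lemma \<gamma>_pow_q_Suc: "\<gamma> ^ ((q + 1) * j) = 1"
proof -
  obtain e where "q + 1 = d * e" using d_dvd by (elim dvdE)
  thus ?thesis using \<gamma> by (simp add: primitive_root_of_unity_def power_mult)
qed

text \<open>Powers of \<open>\<gamma>\<close> have norm one; hence the constant terms of the
  quadratics do not depend on \<open>j\<close>.\<close>

lemma \<gamma>_conj: "\<gamma> ^ j * \<gamma> ^ (q * j) = 1"
  using \<gamma>_pow_q_Suc[of j] by (simp add: power_add algebra_simps)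

lemma \<gamma>_conj_conj: "\<gamma> ^ (q * (q * j)) = \<gamma> ^ j"
proof -
  have "\<gamma> ^ (q * j) * \<gamma> ^ (q * (q * j)) = \<gamma> ^ (q * j) * \<gamma> ^ j"
    unfolding \<gamma>_conj[of "q * j"] using \<gamma>_conj[of j] by (simp only: mult.commute)
  thus ?thesis using \<gamma>_nz by simp
qed

text \<open>The Frobenius map exchanges \<open>\<gamma> ^ j\<close> and
  \<open>\<gamma> ^ (q * j)\<close>. This places \<open>\<delta> j\<close> in the subfield.\<close>

lemma frobenius_trace: "(\<gamma> ^ j + \<gamma> ^ (q * j)) ^ q = \<gamma> ^ j + \<gamma> ^ (q * j)"
  using \<gamma>_conj_conj[of j]
  by (simp add: frobenius_add mult_ac flip: power_mult)

text \<open>The same exchange reverses the difference. To land in the subfield,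
  \<open>\<theta> j\<close> needs a factor that is negated as well; odd powers of
  \<open>\<beta>\<close> provide it.\<close>

lemma frobenius_difference: "(\<gamma> ^ j - \<gamma> ^ (q * j)) ^ q = - (\<gamma> ^ j - \<gamma> ^ (q * j))"
proof -
  have "(\<gamma> ^ j - \<gamma> ^ (q * j)) ^ q = (\<gamma> ^ j) ^ q - (\<gamma> ^ (q * j)) ^ q"
    \<comment> \<open>Additivity is applied to the minuend, written as the difference plus the
      subtrahend.\<close>
    using frobenius_add[of "\<gamma> ^ j - \<gamma> ^ (q * j)" "\<gamma> ^ (q * j)"]
    by simp
  thus ?thesis using \<gamma>_conj_conj[of j] by (simp add: mult_ac flip: power_mult)
qed

text \<open>Both \<open>\<gamma> ^ (q * j)\<close> and \<open>\<gamma> ^ (d - j)\<close> are inverse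
  to \<open>\<gamma> ^ j\<close>, so the conjugate factors supply the upper half of the exponents
  below \<open>d\<close>, and \<open>Y - [:c:]\<close> supplies the exponent zero.\<close>

lemma prod_conjugate_pairs:
  assumes c: "c \<noteq> 0"
  shows "(Y - [:c:]) * (\<Prod>j = 1..(d - 1) div 2. (Y - [:c * \<gamma> ^ j:]) * (Y - [:c * \<gamma> ^ (q * j):])) =
    Y ^ d - [:c ^ d:]"
proof -
  define m where "m = (d - 1) div 2"
  have d_eq: "d = 2 * m + 1" using odd_d by (auto simp: m_def elim!: oddE)
  have conj: "\<gamma> ^ (q * j) = \<gamma> ^ (d - j)" if "j \<le> d" for j
  proof -
    have "\<gamma> ^ j * \<gamma> ^ (d - j) = 1"
      using that \<gamma> by (simp add: primitive_root_of_unity_def flip: power_add)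
    hence "\<gamma> ^ j * \<gamma> ^ (q * j) = \<gamma> ^ j * \<gamma> ^ (d - j)" by (simp only: \<gamma>_conj)
    thus ?thesis using \<gamma>_nz by simp
  qed
  have "(\<Prod>j = 1..m. Y - [:c * \<gamma> ^ (q * j):]) = (\<Prod>j\<in>{m + 1..2 * m}. Y - [:c * \<gamma> ^ j:])"
    by (rule prod.reindex_bij_witness[of _ "\<lambda>j. d - j" "\<lambda>j. d - j"])
       (auto simp: conj d_eq)
  moreover have "{..<d} = insert 0 ({1..m} \<union> {m + 1..2 * m})" by (auto simp: d_eq)
  hence "(\<Prod>j<d. Y - [:c * \<gamma> ^ j:]) =
      (Y - [:c:]) * ((\<Prod>j = 1..m. Y - [:c * \<gamma> ^ j:]) * (\<Prod>j\<in>{m + 1..2 * m}. Y - [:c * \<gamma> ^ j:]))"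
    by (subst prod.union_disjoint[symmetric]) auto
  ultimately show ?thesis
    using prod_minus_primitive_root_powers[OF \<gamma> c, of Y] by (simp add: m_def prod.distrib)
qed

text \<open>Each quadratic splits into a conjugate pair of linear factors, one sign belonging to
  \<open>c\<close> and the other to \<open>- c\<close>. As \<open>d\<close> is odd, the two
  resulting products are \<open>x ^ d - c ^ d\<close> and \<open>x ^ d + c ^ d\<close>.\<close>

lemma prod_trace_quadratics:
  assumes c: "c \<noteq> 0"
  shows "([:c, 1:] * [:- c, 1:]) * (\<Prod>j = 1..(d - 1) div 2.
      [:c\<^sup>2, c * (\<gamma> ^ j + \<gamma> ^ (q * j)), 1:] * [:c\<^sup>2, - (c * (\<gamma> ^ j + \<gamma> ^ (q * j))), 1:]) =
    monom 1 (2 * d) - [:(c\<^sup>2) ^ d:]"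
proof -
  define x where "x = ([:0, 1:] :: 'b poly)"
  have quad: "[:c\<^sup>2, - (c * (\<gamma> ^ j + \<gamma> ^ (q * j))), 1:] = (x - [:c * \<gamma> ^ j:]) * (x - [:c * \<gamma> ^ (q * j):])"
    for c j
  proof -
    have "(c * \<gamma> ^ j) * (c * \<gamma> ^ (q * j)) = c\<^sup>2 * (\<gamma> ^ j * \<gamma> ^ (q * j))"
      by (simp add: power2_eq_square algebra_simps)
    hence "(c * \<gamma> ^ j) * (c * \<gamma> ^ (q * j)) = c\<^sup>2" unfolding \<gamma>_conj by simp
    thus ?thesis by (simp add: x_def algebra_simps)
  qed
  have quad': "[:c\<^sup>2, c * (\<gamma> ^ j + \<gamma> ^ (q * j)), 1:] = (x - [:- c * \<gamma> ^ j:]) * (x - [:- c * \<gamma> ^ (q * j):])"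
    for j using quad[of "- c" j] by simp
  have lin: "[:c, 1:] = x - [:- c:]" "[:- c, 1:] = x - [:c:]" by (auto simp: x_def)
  have x_pow: "x ^ n = monom 1 n" for n by (simp add: x_def monom_altdef)
  have "([:c, 1:] * [:- c, 1:]) * (\<Prod>j = 1..(d - 1) div 2.
      [:c\<^sup>2, c * (\<gamma> ^ j + \<gamma> ^ (q * j)), 1:] * [:c\<^sup>2, - (c * (\<gamma> ^ j + \<gamma> ^ (q * j))), 1:]) =
    ((x - [:- c:]) * (\<Prod>j = 1..(d - 1) div 2. (x - [:- c * \<gamma> ^ j:]) * (x - [:- c * \<gamma> ^ (q * j):]))) *
    ((x - [:c:]) * (\<Prod>j = 1..(d - 1) div 2. (x - [:c * \<gamma> ^ j:]) * (x - [:c * \<gamma> ^ (q * j):])))"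
    unfolding quad quad' lin prod.distrib by (simp only: mult_ac)
  also have "\<dots> = (x ^ d - [:(- c) ^ d:]) * (x ^ d - [:c ^ d:])"
    using c by (subst (1 2) prod_conjugate_pairs) auto
  also have "\<dots> = x ^ d * x ^ d - [:c ^ d * c ^ d:]"
    using odd_d by (simp add: algebra_simps)
  also have "\<dots> = monom 1 (2 * d) - [:(c\<^sup>2) ^ d:]"
    by (simp add: x_pow mult_monom mult_2 power2_eq_square power_mult_distrib)
  finally show ?thesis .
qed

text \<open>Here a single quadratic mixes the signs, with roots such as
  \<open>c * \<gamma> ^ j\<close> and \<open>- c * \<gamma> ^ (q * j)\<close>. Only the two
  quadratics together regroup into conjugate pairs for \<open>c\<close> and for
  \<open>- c\<close>.\<close>

lemma prod_difference_quadratics: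
  assumes c: "c \<noteq> 0"
  shows "(Y\<^sup>2 - [:c\<^sup>2:]) * (\<Prod>j = 1..(d - 1) div 2.
      (Y\<^sup>2 + [:c * (\<gamma> ^ j - \<gamma> ^ (q * j)):] * Y - [:c\<^sup>2:]) *
      (Y\<^sup>2 - [:c * (\<gamma> ^ j - \<gamma> ^ (q * j)):] * Y - [:c\<^sup>2:])) =
    Y ^ (2 * d) - [:(c\<^sup>2) ^ d:]"
proof -
  have quad: "Y\<^sup>2 - [:c * (\<gamma> ^ j - \<gamma> ^ (q * j)):] * Y - [:c\<^sup>2:] =
      (Y - [:c * \<gamma> ^ j:]) * (Y - [:- c * \<gamma> ^ (q * j):])" for c j
  proof -
    have "(c * \<gamma> ^ j) * (c * \<gamma> ^ (q * j)) = c\<^sup>2 * (\<gamma> ^ j * \<gamma> ^ (q * j))"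
      by (simp add: power2_eq_square algebra_simps)
    hence c2: "[:c\<^sup>2:] = [:c * \<gamma> ^ j:] * [:c * \<gamma> ^ (q * j):]"
      unfolding \<gamma>_conj by (simp add: mult_ac)
    have diff: "[:c * (\<gamma> ^ j - \<gamma> ^ (q * j)):] = [:c * \<gamma> ^ j:] - [:c * \<gamma> ^ (q * j):]"
      "[:- c * \<gamma> ^ (q * j):] = - [:c * \<gamma> ^ (q * j):]"
      by (simp_all add: algebra_simps)
    have "Y\<^sup>2 - (A - B) * Y - A * B = (Y - A) * (Y - (- B))" for A B
      by (simp add: power2_eq_square algebra_simps)
    thus ?thesis unfolding c2 diff .
  qed
  have quad': "Y\<^sup>2 + [:c * (\<gamma> ^ j - \<gamma> ^ (q * j)):] * Y - [:c\<^sup>2:] =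
      (Y - [:- c * \<gamma> ^ j:]) * (Y - [:c * \<gamma> ^ (q * j):])" for j
    using quad[of "- c" j] by simp
  have lin: "Y\<^sup>2 - [:c\<^sup>2:] = (Y - [:- c:]) * (Y - [:c:])"
    by (simp add: power2_eq_square algebra_simps)
  have "(Y\<^sup>2 - [:c\<^sup>2:]) * (\<Prod>j = 1..(d - 1) div 2.
      (Y\<^sup>2 + [:c * (\<gamma> ^ j - \<gamma> ^ (q * j)):] * Y - [:c\<^sup>2:]) *
      (Y\<^sup>2 - [:c * (\<gamma> ^ j - \<gamma> ^ (q * j)):] * Y - [:c\<^sup>2:])) =
    ((Y - [:- c:]) * (\<Prod>j = 1..(d - 1) div 2. (Y - [:- c * \<gamma> ^ j:]) * (Y - [:- c * \<gamma> ^ (q * j):]))) *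
    ((Y - [:c:]) * (\<Prod>j = 1..(d - 1) div 2. (Y - [:c * \<gamma> ^ j:]) * (Y - [:c * \<gamma> ^ (q * j):])))"
    unfolding quad quad' lin prod.distrib by (simp only: mult_ac)
  also have "\<dots> = (Y ^ d - [:(- c) ^ d:]) * (Y ^ d - [:c ^ d:])"
    using c by (subst (1 2) prod_conjugate_pairs) auto
  also have "\<dots> = Y ^ d * Y ^ d - [:c ^ d * c ^ d:]"
    using odd_d by (simp add: algebra_simps)
  also have "\<dots> = Y ^ (2 * d) - [:(c\<^sup>2) ^ d:]"
    by (simp add: mult_2 power_add power2_eq_square power_mult_distrib)
  finally show ?thesis .
qed

text \<open>The values \<open>l = 0\<close> and \<open>l = 1\<close> are the preceding formula for
  \<open>b\<close> and for \<open>\<iota> * b\<close>. The square of \<open>\<iota> * b\<close> is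
  the negative of that of \<open>b\<close>, which accounts for the binomial with a plus
  sign.\<close>

lemma prod_difference_trinomials:
  assumes b: "b \<noteq> 0" and \<iota>: "\<iota>\<^sup>2 = - 1"
  shows "((Y\<^sup>2 + [:b\<^sup>2:]) * (Y\<^sup>2 - [:b\<^sup>2:])) * (\<Prod>j = 1..(d - 1) div 2. \<Prod>l = 0..1.
      (Y\<^sup>2 + [:\<iota> ^ l * b * (\<gamma> ^ j - \<gamma> ^ (q * j)):] * Y - [:(\<iota> ^ l * b)\<^sup>2:]) *
      (Y\<^sup>2 - [:\<iota> ^ l * b * (\<gamma> ^ j - \<gamma> ^ (q * j)):] * Y - [:(\<iota> ^ l * b)\<^sup>2:])) =
    Y ^ (4 * d) - [:(b\<^sup>2) ^ (2 * d):]"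
proof -
  define F where "F = (\<lambda>c. \<Prod>j = 1..(d - 1) div 2.
      (Y\<^sup>2 + [:c * (\<gamma> ^ j - \<gamma> ^ (q * j)):] * Y - [:c\<^sup>2:]) *
      (Y\<^sup>2 - [:c * (\<gamma> ^ j - \<gamma> ^ (q * j)):] * Y - [:c\<^sup>2:]))"
  have F: "(Y\<^sup>2 - [:c\<^sup>2:]) * F c = Y ^ (2 * d) - [:(c\<^sup>2) ^ d:]" if "c \<noteq> 0" for c
    unfolding F_def by (rule prod_difference_quadratics[OF that])
  have \<iota>b: "(\<iota> * b)\<^sup>2 = - (b\<^sup>2)" "\<iota> * b \<noteq> 0" using \<iota> b by (auto simp: power_mult_distrib)
  have plus: "Y\<^sup>2 + [:b\<^sup>2:] = Y\<^sup>2 - [:(\<iota> * b)\<^sup>2:]" by (simp add: \<iota>b)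
  have "(\<Prod>j = 1..(d - 1) div 2. \<Prod>l = 0..1.
      (Y\<^sup>2 + [:\<iota> ^ l * b * (\<gamma> ^ j - \<gamma> ^ (q * j)):] * Y - [:(\<iota> ^ l * b)\<^sup>2:]) *
      (Y\<^sup>2 - [:\<iota> ^ l * b * (\<gamma> ^ j - \<gamma> ^ (q * j)):] * Y - [:(\<iota> ^ l * b)\<^sup>2:])) = (\<Prod>l = 0..1. F (\<iota> ^ l * b))"
    unfolding F_def by (rule prod.swap)
  also have "\<dots> = F b * F (\<iota> * b)" by (simp add: prod.atLeast_Suc_atMost)
  finally have "((Y\<^sup>2 + [:b\<^sup>2:]) * (Y\<^sup>2 - [:b\<^sup>2:])) * (\<Prod>j = 1..(d - 1) div 2. \<Prod>l = 0..1.
      (Y\<^sup>2 + [:\<iota> ^ l * b * (\<gamma> ^ j - \<gamma> ^ (q * j)):] * Y - [:(\<iota> ^ l * b)\<^sup>2:]) *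
      (Y\<^sup>2 - [:\<iota> ^ l * b * (\<gamma> ^ j - \<gamma> ^ (q * j)):] * Y - [:(\<iota> ^ l * b)\<^sup>2:])) =
    ((Y\<^sup>2 - [:b\<^sup>2:]) * F b) * ((Y\<^sup>2 + [:b\<^sup>2:]) * F (\<iota> * b))"
    by (simp only: mult_ac)
  also have "\<dots> = (Y ^ (2 * d) - [:(b\<^sup>2) ^ d:]) * (Y ^ (2 * d) - [:(- (b\<^sup>2)) ^ d:])"
    unfolding plus F[OF b] F[OF \<iota>b(2)] unfolding \<iota>b ..
  also have "\<dots> = Y ^ (2 * d) * Y ^ (2 * d) - [:(b\<^sup>2) ^ d * (b\<^sup>2) ^ d:]"
    using odd_d by (simp add: algebra_simps)
  also have "\<dots> = Y ^ (4 * d) - [:(b\<^sup>2) ^ (2 * d):]"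
    by (simp flip: power_add mult_2 add: mult.assoc)
  finally show ?thesis .
qed

text \<open>A linear factor would give a root in the subfield, so the Frobenius map would fix
  \<open>\<gamma> ^ j\<close> or its conjugate. Then \<open>\<gamma> ^ (2 * j) = 1\<close>, which is
  impossible for odd \<open>d\<close> and \<open>0 < j < d\<close>.\<close>

lemma irreducible_trace_quadratic:
  assumes c: "c \<in> range h" "c \<noteq> 0" and j: "1 \<le> j" "j \<le> (d - 1) div 2"
    and g: "map_poly h g = [:c\<^sup>2, c * (\<gamma> ^ j + \<gamma> ^ (q * j)), 1:]"
    and q: "odd q"
  shows "irreducible g"
proof (rule irreducible_monic_factorI)
  interpret map_poly_hom: map_poly_inj_idom_hom h ..
  have deg: "degree g = 2" using arg_cong[OF g, of degree] by simp
  thus "degree g > 0" by simp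
  fix f assume f: "irreducible f" "lead_coeff f = 1" "f dvd g"
  have "degree f \<noteq> 0" using f(1) unfolding irreducible_def by (metis is_unit_iff_degree)
  moreover have False if deg1: "degree f = 1"
  proof -
    obtain a where a: "poly g a = 0"
      using degree_1_monic_factor_root[OF deg1 f(2,3)] .
    define z where "z = h a"
    have "poly (map_poly h g) z = 0" using a by (simp add: z_def poly_map_poly_eval_poly[symmetric])
    \<comment> \<open>The factor \<open>\<gamma> ^ j * \<gamma> ^ (q * j)\<close>, equal to one, is
      inserted so that the quadratic splits by mere expansion.\<close>
    hence "c\<^sup>2 * (\<gamma> ^ j * \<gamma> ^ (q * j)) + z * (c * (\<gamma> ^ j + \<gamma> ^ (q * j)) + z) = 0"
      unfolding \<gamma>_conj g by simp
    hence "(z + c * \<gamma> ^ j) * (z + c * \<gamma> ^ (q * j)) = 0"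
      by (simp add: algebra_simps power2_eq_square)
    hence "z = - c * \<gamma> ^ j \<or> z = - c * \<gamma> ^ (q * j)"
      by (auto simp: add_eq_0_iff2)
    moreover have "z ^ q = z" "c ^ q = c"
      using c power_q_eq_iff by (auto simp: z_def)
    ultimately have "(\<gamma> ^ j) ^ q = \<gamma> ^ j \<or> (\<gamma> ^ (q * j)) ^ q = \<gamma> ^ (q * j)"
      using c q by (auto simp: power_mult_distrib)
    hence "\<gamma> ^ (q * j) = \<gamma> ^ j"
      using \<gamma>_conj_conj[of j] by (auto simp: mult_ac simp flip: power_mult)
    hence "\<gamma> ^ (2 * j) = 1" using \<gamma>_conj[of j] by (simp add: mult_2 power_add)
    hence "d dvd 2 * j" by (rule primitive_root_of_unity_dvd[OF \<gamma>])
    hence "d dvd j" using odd_d by (simp add: coprime_dvd_mult_right_iff)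
    hence "d \<le> j" using j by (intro dvd_imp_le) auto
    thus False using j by auto
  qed
  ultimately have "degree f \<ge> 2" by fastforce
  thus "degree g \<le> degree f" by (simp add: deg)
qed

end

section \<open>Substitution of \<open>x ^ d\<close> and two-power roots of unity\<close>

lemma of_int_poly_cyclotomic_two_power_pcompose:
  "of_int_poly (cyclotomic (2 ^ Suc n)) \<circ>\<^sub>p monom 1 d = (monom 1 (d * 2 ^ n) + 1 :: 'a::field poly)"
proof -
  have "monom 1 N \<circ>\<^sub>p monom 1 d = (monom 1 (d * N) :: 'a poly)" for N
    by (simp add: monom_altdef[of 1 N] pcompose_hom.hom_power pcompose_pCons monom_power)
  thus ?thesis by (simp add: cyclotomic_two_power hom_distribs pcompose_add pcompose_1 del: power_Suc)
qed

lemma monic_monom_add: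
  fixes p :: "'a::field poly"
  assumes "degree p < n"
  shows "degree (monom 1 n + p) = n" "lead_coeff (monom 1 n + p) = 1"
proof -
  show "degree (monom 1 n + p) = n"
    using assms by (subst degree_add_eq_left) (auto simp: degree_monom_eq)
  thus "lead_coeff (monom 1 n + p) = 1" using assms by (simp add: coeff_eq_0)
qed

text \<open>The half power is a square root of one other than one. Being equal to
  \<open>- 1\<close>, it also shows \<open>- 1 \<noteq> 1\<close>, which excludes characteristic
  two.\<close>

lemma primitive_root_of_unity_two_power_half:
  fixes a :: "'a::field"
  assumes a: "primitive_root_of_unity (2 ^ s) a" and s: "s \<ge> 1"
  shows "a ^ 2 ^ (s - 1) = - 1" "(2::'a) \<noteq> 0"
proof -
  obtain v where v: "s = Suc v" using s by (cases s) auto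
  have sq: "(a ^ 2 ^ v)\<^sup>2 = 1" using a by (simp add: v primitive_root_of_unity_def flip: power_mult) (simp add: mult.commute)
  have ne: "a ^ 2 ^ v \<noteq> 1" using a by (simp add: v primitive_root_of_unity_def)
  with sq show *: "a ^ 2 ^ (s - 1) = - 1" by (simp add: v power2_eq_1_iff)
  show "(2::'a) \<noteq> 0"
  proof
    assume "(2::'a) = 0"
    hence "(- 1::'a) = 1" by (metis add.inverse_unique one_add_one)
    thus False using * ne by (simp add: v)
  qed
qed

section \<open>The two factorisations\<close>

theorem theorem3p2:
  fixes h :: "'a::{field,finite} \<Rightarrow> 'b::{field,finite}"
    and q d s :: nat
    and \<alpha> :: "nat \<Rightarrow> 'a"
    and \<beta> \<gamma> :: 'b
    and \<delta> \<theta> :: "nat \<Rightarrow> 'b"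
  assumes q: "CARD('a) = q" "CARD('b) = q\<^sup>2"
    and h: "field_hom h"
    and q_mod_4: "[q = 1] (mod 4)"
    and d: "odd d" "[int q = -1] (mod int d)"
    and s: "s = multiplicity 2 (q - 1)"
    and \<alpha>_prim: "primitive_root_of_unity (2 ^ s) (\<alpha> s)"
    and \<alpha>: "\<And>k. 1 \<le> k \<Longrightarrow> k \<le> s \<Longrightarrow> \<alpha> k = \<alpha> s ^ (2 ^ (s - k))"
    and \<beta>: "\<beta>\<^sup>2 = h (\<alpha> s)"
    and \<gamma>: "primitive_root_of_unity d \<gamma>"
    and \<delta>: "\<And>j. \<delta> j = \<gamma> ^ j + \<gamma> ^ (q * j)"
    and \<theta>: "\<And>j. \<theta> j = \<gamma> ^ j - \<gamma> ^ (q * j)"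
  shows
    "(\<forall>k. 2 \<le> k \<and> k \<le> s \<longrightarrow>
       map_poly h (of_int_poly (cyclotomic (2 ^ k)) \<circ>\<^sub>p monom 1 d) =
         (\<Prod>i = 1..2 ^ (k - 2).
            ([:h (\<alpha> k ^ (2 * i - 1)), 1:] * [:- h (\<alpha> k ^ (2 * i - 1)), 1:]) *
            (\<Prod>j = 1..(d - 1) div 2.
               [:h (\<alpha> (k - 1) ^ (2 * i - 1)), h (\<alpha> k ^ (2 * i - 1)) * \<delta> j, 1:] *
               [:h (\<alpha> (k - 1) ^ (2 * i - 1)), - (h (\<alpha> k ^ (2 * i - 1)) * \<delta> j), 1:])) \<and>
       factors_into_monic_irreducibles h
         (of_int_poly (cyclotomic (2 ^ k)) \<circ>\<^sub>p monom 1 d) (2 ^ (k - 2) * (d + 1))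
         (\<Sum>i = 1..2 ^ (k - 2).
            {#[:h (\<alpha> k ^ (2 * i - 1)), 1:], [:- h (\<alpha> k ^ (2 * i - 1)), 1:]#} +
            (\<Sum>j = 1..(d - 1) div 2.
               {#[:h (\<alpha> (k - 1) ^ (2 * i - 1)), h (\<alpha> k ^ (2 * i - 1)) * \<delta> j, 1:],
                 [:h (\<alpha> (k - 1) ^ (2 * i - 1)), - (h (\<alpha> k ^ (2 * i - 1)) * \<delta> j), 1:]#})) \<and>
       (\<forall>i\<in>{1..2 ^ (k - 2)}. \<forall>j\<in>{1..(d - 1) div 2}.
          h (\<alpha> k ^ (2 * i - 1)) * \<delta> j \<in> range h)) \<and>
     (\<forall>r\<ge>1.
       map_poly h (of_int_poly (cyclotomic (2 ^ (s + r))) \<circ>\<^sub>p monom 1 d) =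
         (\<Prod>i = 1..2 ^ (s - 2).
            ((monom 1 (2 ^ r) + [:h (\<alpha> s ^ (2 * i - 1)):]) *
             (monom 1 (2 ^ r) - [:h (\<alpha> s ^ (2 * i - 1)):])) *
            (\<Prod>j = 1..(d - 1) div 2. \<Prod>l = 0..1.
               (monom 1 (2 ^ r) + monom (h (\<alpha> 2) ^ l * \<beta> ^ (2 * i - 1) * \<theta> j) (2 ^ (r - 1))
                  - [:h (\<alpha> 1 ^ l * \<alpha> s ^ (2 * i - 1)):]) *
               (monom 1 (2 ^ r) - monom (h (\<alpha> 2) ^ l * \<beta> ^ (2 * i - 1) * \<theta> j) (2 ^ (r - 1))
                  - [:h (\<alpha> 1 ^ l * \<alpha> s ^ (2 * i - 1)):]))) \<and>
       factors_into_monic_irreducibles h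
         (of_int_poly (cyclotomic (2 ^ (s + r))) \<circ>\<^sub>p monom 1 d) (2 ^ (s - 1) * d)
         (\<Sum>i = 1..2 ^ (s - 2).
            {#monom 1 (2 ^ r) + [:h (\<alpha> s ^ (2 * i - 1)):],
              monom 1 (2 ^ r) - [:h (\<alpha> s ^ (2 * i - 1)):]#} +
            (\<Sum>j = 1..(d - 1) div 2. \<Sum>l = 0..1.
               {#monom 1 (2 ^ r) + monom (h (\<alpha> 2) ^ l * \<beta> ^ (2 * i - 1) * \<theta> j) (2 ^ (r - 1))
                  - [:h (\<alpha> 1 ^ l * \<alpha> s ^ (2 * i - 1)):],
                 monom 1 (2 ^ r) - monom (h (\<alpha> 2) ^ l * \<beta> ^ (2 * i - 1) * \<theta> j) (2 ^ (r - 1))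
                  - [:h (\<alpha> 1 ^ l * \<alpha> s ^ (2 * i - 1)):]#})) \<and>
       (\<forall>i\<in>{1..2 ^ (s - 2)}. \<forall>j\<in>{1..(d - 1) div 2}. \<forall>l\<in>{0..1}.
          h (\<alpha> 2) ^ l * \<beta> ^ (2 * i - 1) * \<theta> j \<in> range h))"
proof -
  interpret field_hom h by fact
  interpret map_poly_hom: map_poly_inj_idom_hom h ..
  have "int d dvd int (q + 1)" using d(2) by (simp add: cong_iff_dvd_diff add.commute)
  hence "d dvd q + 1" by (simp only: of_nat_dvd_iff)
  then interpret odd_order_root_of_unity h q d \<gamma>
    using q(1) d(1) \<gamma> by unfold_locales auto

  have q1: "q > 1" using card_field_gt_1[where 'a = 'a] q(1) by simp
  have "4 dvd q - 1" using q_mod_4 q1 by (simp add: cong_altdef_nat)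
  hence s2: "s \<ge> 2" unfolding s using q1 by (intro multiplicity_geI) auto
  \<comment> \<open>The exponent \<open>s\<close> is exact, so \<open>t\<close> is odd. This yields
    both \<open>\<beta> ^ q = - \<beta>\<close> and the divisibility of degrees in (ii).\<close>
  obtain t where t: "q - 1 = 2 ^ s * t" "odd t"
    using multiplicity_decompose'[of "q - 1" 2] q1 unfolding s by auto
  have q_eq: "q = Suc (2 ^ s * t)" using t(1) q1 by simp
  hence q_int: "int CARD('a) = 1 + 2 ^ s * int t" by (simp add: q(1))
  have odd_q: "odd q" using s2 by (simp add: q_eq)

  \<comment> \<open>This matches the hypothesis of \<open>prod_odd_powers\<close> when
    \<open>w\<close> is a constant polynomial.\<close>
  have minus_1: "[:- 1:] = (- 1 :: 'b poly)" by (simp add: one_pCons del: pCons_one)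
  have half: "\<alpha> s ^ 2 ^ (s - 1) = - 1" and two: "(2::'a) \<noteq> 0"
    using primitive_root_of_unity_two_power_half[OF \<alpha>_prim] s2 by auto
  have \<alpha>_half: "\<alpha> k ^ 2 ^ (k - 1) = - 1" if "1 \<le> k" "k \<le> s" for k
  proof -
    have "2 ^ (s - k) * 2 ^ (k - 1) = (2::nat) ^ (s - 1)" using that by (simp flip: power_add)
    thus ?thesis using \<alpha>[OF that] half by (simp flip: power_mult)
  qed
  have \<alpha>_sq: "\<alpha> (k - 1) = (\<alpha> k)\<^sup>2" if "2 \<le> k" "k \<le> s" for k
  proof -
    have "s - (k - 1) = Suc (s - k)" using that by simp
    thus ?thesis using \<alpha>[of k] \<alpha>[of "k - 1"] that by (simp add: mult.commute flip: power_mult)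
  qed
  have \<alpha>_nz: "\<alpha> k \<noteq> 0" if "1 \<le> k" "k \<le> s" for k
    using \<alpha>_half[OF that] by (auto simp: power_0_left split: if_splits)

  have trace_range: "c * \<delta> j \<in> range h" if "c \<in> range h" for c j
    using that frobenius_trace[of j] by (simp add: power_mult_distrib \<delta> flip: power_q_eq_iff)

  have part1:
    "map_poly h (of_int_poly (cyclotomic (2 ^ k)) \<circ>\<^sub>p monom 1 d) = (\<Prod>i = 1..2 ^ (k - 2).
       ([:c i, 1:] * [:- c i, 1:]) * (\<Prod>j = 1..(d - 1) div 2.
          [:e i, c i * \<delta> j, 1:] * [:e i, - (c i * \<delta> j), 1:])) \<and>
     factors_into_monic_irreducibles h (of_int_poly (cyclotomic (2 ^ k)) \<circ>\<^sub>p monom 1 d)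
       (2 ^ (k - 2) * (d + 1)) (\<Sum>i = 1..2 ^ (k - 2). {#[:c i, 1:], [:- c i, 1:]#} +
         (\<Sum>j = 1..(d - 1) div 2. {#[:e i, c i * \<delta> j, 1:], [:e i, - (c i * \<delta> j), 1:]#}))"
    if k: "2 \<le> k" "k \<le> s" and c: "c = (\<lambda>i. h (\<alpha> k ^ (2 * i - 1)))"
      and e: "e = (\<lambda>i. h (\<alpha> (k - 1) ^ (2 * i - 1)))" for k c e
  proof -
    have e_sq: "e i = (c i)\<^sup>2" for i
      using \<alpha>_sq[OF k] by (simp add: c e mult.commute flip: power_mult hom_power)
    have c_nz: "c i \<noteq> 0" for i using \<alpha>_nz[of k] k by (simp add: c)
    have c_range: "c i \<in> range h" for i by (simp add: c)
    have "map_poly h (of_int_poly (cyclotomic (2 ^ k)) \<circ>\<^sub>p monom 1 d) = monom 1 (d * 2 ^ (k - 1)) + 1"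
      using of_int_poly_cyclotomic_two_power_pcompose[of "k - 1" d, where 'a = 'a] k
      by (simp add: hom_distribs)
    also have "\<dots> = monom 1 (2 * d) ^ 2 ^ (k - 2) + 1"
    proof -
      have "k - 1 = Suc (k - 2)" using k by simp
      thus ?thesis by (simp add: monom_power mult_ac)
    qed
    \<comment> \<open>Here \<open>w\<close> is the constant \<open>\<alpha> (k - 1) ^ d\<close>,
      whose power with exponent \<open>2 ^ (k - 2)\<close> is \<open>- 1\<close> because
      \<open>d\<close> is odd.\<close>
    also have "\<dots> = (\<Prod>i = 1..2 ^ (k - 2). monom 1 (2 * d) - [:h (\<alpha> (k - 1)) ^ d:] ^ (2 * i - 1))"
    proof (rule prod_odd_powers[symmetric])
      have "(h (\<alpha> (k - 1)) ^ d) ^ 2 ^ (k - 2) = h (\<alpha> (k - 1) ^ 2 ^ (k - 2)) ^ d"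
        by (simp add: hom_power mult.commute flip: power_mult)
      also have "\<alpha> (k - 1) ^ 2 ^ (k - 2) = - 1"
        using \<alpha>_half[of "k - 1"] k by (simp add: diff_diff_left numeral_2_eq_2)
      finally have "(h (\<alpha> (k - 1)) ^ d) ^ 2 ^ (k - 2) = - 1" using d(1) by (simp add: hom_uminus)
      thus "[:h (\<alpha> (k - 1)) ^ d:] ^ 2 ^ (k - 2) = - 1" by (simp only: poly_const_pow minus_1)
    qed
    also have "\<dots> = (\<Prod>i = 1..2 ^ (k - 2). monom 1 (2 * d) - [:((c i)\<^sup>2) ^ d:])"
      by (simp add: poly_const_pow e hom_power mult.commute flip: power_mult e_sq)
    also have "\<dots> = (\<Prod>i = 1..2 ^ (k - 2). ([:c i, 1:] * [:- c i, 1:]) * (\<Prod>j = 1..(d - 1) div 2.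
          [:e i, c i * \<delta> j, 1:] * [:e i, - (c i * \<delta> j), 1:]))"
      unfolding e_sq \<delta> prod_trace_quadratics[OF c_nz] ..
    finally have prod: "map_poly h (of_int_poly (cyclotomic (2 ^ k)) \<circ>\<^sub>p monom 1 d) = \<dots>" .
    have lin: "\<exists>g. [:h u, 1:] = map_poly h g \<and> lead_coeff g = 1 \<and> irreducible g" for u
      by (intro exI[of _ "[:u, 1:]"]) (simp add: irreducible_linear_field_poly del: pCons_one)
    have quad: "\<exists>g. [:b\<^sup>2, b * \<delta> j, 1:] = map_poly h g \<and> lead_coeff g = 1 \<and> irreducible g"
      if b: "b \<in> range h" "b \<noteq> 0" and j: "j \<in> {1..(d - 1) div 2}" for b j
    proof -
      obtain u v where u: "b = h u" and v: "b * \<delta> j = h v"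
        using b trace_range[of b j] by blast
      have g: "map_poly h [:u\<^sup>2, v, 1:] = [:b\<^sup>2, b * \<delta> j, 1:]" unfolding v by (simp add: u hom_distribs)
      moreover have "irreducible [:u\<^sup>2, v, 1:]"
        using irreducible_trace_quadratic[OF b _ _ g[unfolded \<delta>] odd_q] j by simp
      ultimately show ?thesis by (intro exI[of _ "[:u\<^sup>2, v, 1:]"]) simp
    qed
    have "factors_into_monic_irreducibles h (of_int_poly (cyclotomic (2 ^ k)) \<circ>\<^sub>p monom 1 d)
       (2 ^ (k - 2) * (d + 1)) (\<Sum>i = 1..2 ^ (k - 2). {#[:c i, 1:], [:- c i, 1:]#} +
         (\<Sum>j = 1..(d - 1) div 2. {#[:e i, c i * \<delta> j, 1:], [:e i, - (c i * \<delta> j), 1:]#}))"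
      (is "factors_into_monic_irreducibles h ?f ?n ?M")
    proof (rule factors_into_monic_irreduciblesI[OF h])
      show "map_poly h ?f = prod_mset ?M" unfolding prod
        by (simp only: prod_mset_sum prod_mset.union prod_mset.add_mset prod_mset.empty mult_1_right mult.assoc)
      \<comment> \<open>Each \<open>i\<close> contributes two linear factors and
        \<open>d - 1\<close> quadratic ones.\<close>
      show "size ?M = ?n" using d(1) by (auto elim!: oddE)
      define Q where "Q p \<longleftrightarrow> (\<exists>g. p = map_poly h g \<and> lead_coeff g = 1 \<and> irreducible g)" for p
      have "Q [:c i, 1:]" "Q [:- c i, 1:]" for i
        using lin[of "\<alpha> k ^ (2 * i - 1)"] lin[of "- (\<alpha> k ^ (2 * i - 1))"]
        unfolding Q_def c by (simp_all only: hom_uminus)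
      moreover have "Q [:e i, c i * \<delta> j, 1:]" "Q [:e i, - (c i * \<delta> j), 1:]"
        if j: "j \<in> {1..(d - 1) div 2}" for i j
      proof -
        \<comment> \<open>The quadratic with the minus sign is the one with the plus sign for
          \<open>- c i\<close>.\<close>
        have neg: "- c i \<in> range h" "- c i \<noteq> 0" using c_nz[of i] by (auto simp: c simp flip: hom_uminus)
        show "Q [:e i, c i * \<delta> j, 1:]" unfolding Q_def e_sq by (rule quad[OF c_range c_nz j])
        show "Q [:e i, - (c i * \<delta> j), 1:]" using quad[OF neg j] by (simp add: Q_def e_sq)
      qed
      ultimately have "Q p" if "p \<in># ?M" for p using that by (auto simp: set_mset_sum)
      thus "\<exists>g. p = map_poly h g \<and> lead_coeff g = 1 \<and> (g dvd ?f \<longrightarrow> irreducible g)"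
        if "p \<in># ?M" for p using that unfolding Q_def by blast
    qed
    thus ?thesis using prod by blast
  qed

  \<comment> \<open>The argument of \<open>\<alpha>\<close> is the exponent of two, so
    \<open>\<alpha> 2\<close> has order four and its image is a square root of
    \<open>- 1\<close>.\<close>
  define \<iota> where "\<iota> = h (\<alpha> 2)"
  have \<iota>_range: "\<iota> ^ l \<in> range h" for l by (simp add: \<iota>_def flip: hom_power)
  have \<alpha>1: "\<alpha> 1 = - 1" using \<alpha>_half[of 1] s2 by simp
  have \<iota>_sq: "\<iota>\<^sup>2 = - 1"
    using \<alpha>_sq[of 2] s2 \<alpha>1 by (simp add: \<iota>_def hom_distribs flip: hom_power)
  have \<beta>_nz: "\<beta> \<noteq> 0" using \<beta> \<alpha>_nz[of s] s2 by auto
  \<comment> \<open>With \<open>q = 1 + 2 ^ s * t\<close>, the power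
    \<open>\<beta> ^ (q - 1)\<close> is \<open>(- 1) ^ t\<close>, and \<open>t\<close> is
    odd.\<close>
  have \<beta>_q: "\<beta> ^ q = - \<beta>"
  proof -
    have "2 ^ s = 2 * (2::nat) ^ (s - 1)" using s2 by (simp flip: power_Suc)
    hence "\<beta> ^ (2 ^ s * t) = h (\<alpha> s ^ 2 ^ (s - 1)) ^ t"
      by (simp add: power_mult \<beta> hom_power)
    thus ?thesis unfolding half using t(2) by (simp add: q_eq hom_uminus)
  qed
  \<comment> \<open>The Frobenius map negates both the odd power of \<open>\<beta>\<close> and
    \<open>\<theta> j\<close>, so the signs cancel. Since subtraction truncates,
    \<open>2 * i - 1\<close> is odd only for \<open>i \<ge> 1\<close>.\<close>
  have difference_range: "\<iota> ^ l * \<beta> ^ (2 * i - 1) * \<theta> j \<in> range h" if "i \<ge> 1" for l i j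
  proof -
    have "(\<beta> ^ (2 * i - 1)) ^ q = (\<beta> ^ q) ^ (2 * i - 1)" by (simp add: mult.commute flip: power_mult)
    also have "\<dots> = - (\<beta> ^ (2 * i - 1))" unfolding \<beta>_q using that by simp
    finally have "(\<beta> ^ (2 * i - 1)) ^ q = - (\<beta> ^ (2 * i - 1))" .
    moreover have "(\<iota> ^ l) ^ q = \<iota> ^ l" using \<iota>_range power_q_eq_iff by blast
    ultimately show ?thesis
      using frobenius_difference[of j, folded \<theta>] by (simp add: power_mult_distrib flip: power_q_eq_iff)
  qed

  have part2:
    "map_poly h (of_int_poly (cyclotomic (2 ^ (s + r))) \<circ>\<^sub>p monom 1 d) = (\<Prod>i = 1..2 ^ (s - 2).
       ((monom 1 (2 ^ r) + [:a i:]) * (monom 1 (2 ^ r) - [:a i:])) *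
       (\<Prod>j = 1..(d - 1) div 2. \<Prod>l = 0..1.
          (monom 1 (2 ^ r) + monom (u i j l) (2 ^ (r - 1)) - [:v i l:]) *
          (monom 1 (2 ^ r) - monom (u i j l) (2 ^ (r - 1)) - [:v i l:]))) \<and>
     factors_into_monic_irreducibles h (of_int_poly (cyclotomic (2 ^ (s + r))) \<circ>\<^sub>p monom 1 d)
       (2 ^ (s - 1) * d)
       (\<Sum>i = 1..2 ^ (s - 2). {#monom 1 (2 ^ r) + [:a i:], monom 1 (2 ^ r) - [:a i:]#} +
         (\<Sum>j = 1..(d - 1) div 2. \<Sum>l = 0..1.
            {#monom 1 (2 ^ r) + monom (u i j l) (2 ^ (r - 1)) - [:v i l:],
              monom 1 (2 ^ r) - monom (u i j l) (2 ^ (r - 1)) - [:v i l:]#}))"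
    if r: "r \<ge> 1" and a: "a = (\<lambda>i. h (\<alpha> s ^ (2 * i - 1)))"
      and u: "u = (\<lambda>i j l. \<iota> ^ l * \<beta> ^ (2 * i - 1) * \<theta> j)"
      and v: "v = (\<lambda>i l. h (\<alpha> 1 ^ l * \<alpha> s ^ (2 * i - 1)))" for r a u v
  proof -
    \<comment> \<open>Since \<open>r \<ge> 1\<close>, all factors in (ii) are quadratic polynomials
      in this \<open>Y\<close>.\<close>
    define Y :: "'b poly" where "Y = monom 1 (2 ^ (r - 1))"
    have Y_sq: "monom 1 (2 ^ r) = Y\<^sup>2"
    proof -
      have "r = Suc (r - 1)" using r by simp
      hence "(2::nat) ^ r = 2 ^ (r - 1) * 2" by (metis power_Suc2)
      thus ?thesis by (simp add: Y_def monom_power)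
    qed
    have Y_smult: "monom z (2 ^ (r - 1)) = [:z:] * Y" for z by (simp add: Y_def smult_monom)
    have a_eq: "a i = (\<beta> ^ (2 * i - 1))\<^sup>2" for i
      by (simp add: a hom_power mult.commute flip: \<beta> power_mult)
    have v_eq: "v i l = (\<iota> ^ l * \<beta> ^ (2 * i - 1))\<^sup>2" for i l
    proof -
      have "h (\<alpha> 1) = \<iota>\<^sup>2" unfolding \<alpha>1 \<iota>_sq by (simp add: hom_uminus)
      hence "v i l = (\<iota>\<^sup>2) ^ l * a i" by (simp only: v a hom_mult hom_power)
      thus ?thesis by (simp add: a_eq power_mult_distrib mult.commute flip: power_mult)
    qed
    let ?f = "of_int_poly (cyclotomic (2 ^ (s + r))) \<circ>\<^sub>p monom 1 d :: 'a poly"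
    have f: "?f = monom 1 (d * 2 ^ (s + r - 1)) + 1"
      using of_int_poly_cyclotomic_two_power_pcompose[of "s + r - 1" d, where 'a = 'a] r by simp
    hence "map_poly h ?f = monom 1 (d * 2 ^ (s + r - 1)) + 1" by (simp add: hom_distribs)
    also have "\<dots> = (Y ^ (4 * d)) ^ 2 ^ (s - 2) + 1"
    proof -
      have "s + r - 1 = (r - 1) + (s - 2) + 2" using s2 r by simp
      hence "(2::nat) ^ (s + r - 1) = 2 ^ (r - 1) * 2 ^ (s - 2) * 4" by (simp only: power_add) simp
      thus ?thesis by (simp add: Y_def monom_power mult_ac)
    qed
    \<comment> \<open>Now \<open>w\<close> is the constant \<open>\<alpha> s ^ (2 * d)\<close>; the
      exponent \<open>2 * 2 ^ (s - 2)\<close> is the half order \<open>2 ^ (s - 1)\<close>, so again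
      \<open>w ^ 2 ^ (s - 2) = - 1\<close>.\<close>
    also have "\<dots> = (\<Prod>i = 1..2 ^ (s - 2). Y ^ (4 * d) - [:h (\<alpha> s) ^ (2 * d):] ^ (2 * i - 1))"
    proof (rule prod_odd_powers[symmetric])
      have "s - 1 = Suc (s - 2)" using s2 by simp
      hence "(2::nat) ^ (s - 1) = 2 * 2 ^ (s - 2)" by (simp only: power_Suc)
      hence "(h (\<alpha> s) ^ (2 * d)) ^ 2 ^ (s - 2) = h (\<alpha> s ^ 2 ^ (s - 1)) ^ d"
        by (simp add: hom_power mult_ac flip: power_mult)
      hence "(h (\<alpha> s) ^ (2 * d)) ^ 2 ^ (s - 2) = - 1" unfolding half using d(1) by (simp add: hom_uminus)
      thus "[:h (\<alpha> s) ^ (2 * d):] ^ 2 ^ (s - 2) = - 1" by (simp only: poly_const_pow minus_1)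
    qed
    also have "\<dots> = (\<Prod>i = 1..2 ^ (s - 2). Y ^ (4 * d) - [:((\<beta> ^ (2 * i - 1))\<^sup>2) ^ (2 * d):])"
      unfolding a_eq[symmetric] a by (simp add: poly_const_pow hom_power mult_ac flip: power_mult)
    also have "\<dots> = (\<Prod>i = 1..2 ^ (s - 2).
       ((monom 1 (2 ^ r) + [:a i:]) * (monom 1 (2 ^ r) - [:a i:])) *
       (\<Prod>j = 1..(d - 1) div 2. \<Prod>l = 0..1.
          (monom 1 (2 ^ r) + monom (u i j l) (2 ^ (r - 1)) - [:v i l:]) *
          (monom 1 (2 ^ r) - monom (u i j l) (2 ^ (r - 1)) - [:v i l:])))"
      unfolding Y_sq Y_smult a_eq v_eq u \<theta>
      using \<beta>_nz by (subst prod_difference_trinomials[OF _ \<iota>_sq]) auto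
    finally have prod: "map_poly h ?f = \<dots>" .
    \<comment> \<open>Every irreducible factor of \<open>?f\<close> has degree divisible by
      \<open>2 ^ r\<close>, so any monic divisor of degree \<open>2 ^ r\<close> is irreducible.
      Binomials and trinomials are thus treated alike.\<close>
    have irred: "\<exists>g. monom 1 (2 ^ r) + map_poly h w = map_poly h g \<and> lead_coeff g = 1 \<and> (g dvd ?f \<longrightarrow> irreducible g)"
      if w: "degree w < 2 ^ r" for w
    proof (intro exI[of _ "monom 1 (2 ^ r) + w"] conjI impI)
      show "lead_coeff (monom 1 (2 ^ r) + w) = 1" by (rule monic_monom_add(2)[OF w])
      assume dvd: "monom 1 (2 ^ r) + w dvd ?f"
      show "irreducible (monom 1 (2 ^ r) + w)"
      proof (rule irreducible_monic_factorI)
        fix g assume g: "irreducible g" "g dvd monom 1 (2 ^ r) + w"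
        have "2 ^ r dvd degree g"
          using dvd_trans[OF g(2) dvd] unfolding f
          by (rule two_power_dvd_degree_irreducible_factor[OF g(1) _ d(1) two q_int])
             (use t s2 in auto)
        moreover have "degree g > 0" using g(1) unfolding irreducible_def by (metis is_unit_iff_degree not_gr_zero)
        ultimately show "degree (monom 1 (2 ^ r) + w) \<le> degree g"
          unfolding monic_monom_add(1)[OF w] by (intro dvd_imp_le)
      qed (simp add: monic_monom_add(1)[OF w])
    qed (simp add: hom_distribs)
    have bin: "\<exists>g. monom 1 (2 ^ r) + [:h y:] = map_poly h g \<and> lead_coeff g = 1 \<and> (g dvd ?f \<longrightarrow> irreducible g)"
      for y using irred[of "[:y:]"] by (simp add: hom_distribs)
    have tri: "\<exists>g. monom 1 (2 ^ r) + (monom (h x) (2 ^ (r - 1)) - [:h y:]) = map_poly h g \<and> lead_coeff g = 1 \<and>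
        (g dvd ?f \<longrightarrow> irreducible g)" for x y
    proof -
      have "degree (monom x (2 ^ (r - 1)) - [:y:]) \<le> 2 ^ (r - 1)"
        by (intro degree_diff_le degree_monom_le) auto
      also have "\<dots> < (2::nat) ^ r" using r by simp
      finally show ?thesis using irred[of "monom x (2 ^ (r - 1)) - [:y:]"] by (simp add: hom_distribs)
    qed
    have "factors_into_monic_irreducibles h ?f (2 ^ (s - 1) * d)
       (\<Sum>i = 1..2 ^ (s - 2). {#monom 1 (2 ^ r) + [:a i:], monom 1 (2 ^ r) - [:a i:]#} +
         (\<Sum>j = 1..(d - 1) div 2. \<Sum>l = 0..1.
            {#monom 1 (2 ^ r) + monom (u i j l) (2 ^ (r - 1)) - [:v i l:],
              monom 1 (2 ^ r) - monom (u i j l) (2 ^ (r - 1)) - [:v i l:]#}))"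
      (is "factors_into_monic_irreducibles h _ ?n ?M")
    proof (rule factors_into_monic_irreduciblesI[OF h])
      show "map_poly h ?f = prod_mset ?M" unfolding prod
        by (simp only: prod_mset_sum prod_mset.union prod_mset.add_mset prod_mset.empty mult_1_right mult.assoc)
      \<comment> \<open>Each \<open>i\<close> contributes two binomials and
        \<open>2 * (d - 1)\<close> trinomials, hence \<open>2 * d\<close> factors.\<close>
      have "2 ^ (s - 1) = 2 * (2::nat) ^ (s - 2)"
        using s2 by (metis Suc_diff_le diff_Suc_Suc numeral_2_eq_2 power_Suc One_nat_def)
      thus "size ?M = ?n" using d(1) by (auto elim!: oddE)
      define Q where "Q p \<longleftrightarrow> (\<exists>g. p = map_poly h g \<and> lead_coeff g = 1 \<and> (g dvd ?f \<longrightarrow> irreducible g))"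
        for p
      have "Q (monom 1 (2 ^ r) + [:a i:])" "Q (monom 1 (2 ^ r) - [:a i:])" for i
      proof -
        show "Q (monom 1 (2 ^ r) + [:a i:])" unfolding Q_def a by (rule bin)
        have "monom 1 (2 ^ r) - [:a i:] = monom 1 (2 ^ r) + [:h (- (\<alpha> s ^ (2 * i - 1))):]"
          by (subst diff_conv_add_uminus) (simp add: a hom_uminus)
        thus "Q (monom 1 (2 ^ r) - [:a i:])" unfolding Q_def by (simp only: bin)
      qed
      moreover have "Q (monom 1 (2 ^ r) + monom (u i j l) (2 ^ (r - 1)) - [:v i l:])"
        "Q (monom 1 (2 ^ r) - monom (u i j l) (2 ^ (r - 1)) - [:v i l:])" if i: "i \<in> {1..2 ^ (s - 2)}" for i j l
      proof -
        obtain x where x: "u i j l = h x" using difference_range[of i l j] i unfolding u by auto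
        have "monom 1 (2 ^ r) + monom (u i j l) (2 ^ (r - 1)) - [:v i l:] =
            monom 1 (2 ^ r) + (monom (h x) (2 ^ (r - 1)) - [:v i l:])"
          unfolding x by (rule add_diff_eq[symmetric])
        thus "Q (monom 1 (2 ^ r) + monom (u i j l) (2 ^ (r - 1)) - [:v i l:])"
          unfolding Q_def v by (simp only: tri)
        have "monom 1 (2 ^ r) - monom (u i j l) (2 ^ (r - 1)) - [:v i l:] =
            monom 1 (2 ^ r) + (monom (h (- x)) (2 ^ (r - 1)) - [:v i l:])"
          unfolding x hom_uminus minus_monom[symmetric] by (simp only: diff_conv_add_uminus add.assoc)
        thus "Q (monom 1 (2 ^ r) - monom (u i j l) (2 ^ (r - 1)) - [:v i l:])"
          unfolding Q_def v by (simp only: tri)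
      qed
      ultimately have "Q p" if "p \<in># ?M" for p using that by (auto simp: set_mset_sum)
      thus "\<exists>g. p = map_poly h g \<and> lead_coeff g = 1 \<and> (g dvd ?f \<longrightarrow> irreducible g)"
        if "p \<in># ?M" for p using that unfolding Q_def by blast
    qed
    thus ?thesis using prod by blast
  qed

  show ?thesis
    using part1[OF _ _ refl refl] part2[OF _ refl refl refl] trace_range difference_range
    unfolding \<iota>_def by auto
qed

end
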